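(* Let $G$ be either a cyclic subgroup or a one-parameter continuous subgroup of the affine group $\mathcal G$, and let $G\ni g\mapsto U_g$ be a unitary representation of $G$ in a Hilbert space $\mathcal H$ (strongly continuous if $G$ is a continuous group). Assume that $\dot A$ is a closed densely defined symmetric operator in $\mathcal H$ with finite deficiency indices which is $G$-invariant with respect to this representation. Then $\dot A$ admits a $G$-invariant maximal dissipative extension.
   Context: $\mathcal G$ is the group (under composition) of affine maps $g(x)=ax+b$ of $\mathbb R$ with $a>0$, $b\in\mathbb R$; for an operator $A$, $g(A)=aA+bI$. A densely defined closed operator $A$ is $G$-invariant (with respect to $g\mapsto U_g$) if $U_g(\mathrm{Dom}(A))=\mathrm{Dom}(A)$ and $U_gAU_g^*f=aAf+bf$ for all $f\in\mathrm{Dom}(A)$ and all $g\in G$. An operator is maximal dissipative if $\operatorname{Im}(Af,f)\ge0$ on its domain and it has no proper dissipative extension. *)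

theory Defs
  imports "HOL-Analysis.Analysis"
begin

class complex_inner_space = real_normed_vector +
  fixes scaleC :: "complex \<Rightarrow> 'a \<Rightarrow> 'a" (infixr "*\<^sub>C" 75)
    and cinner :: "'a \<Rightarrow> 'a \<Rightarrow> complex"
  assumes scaleC_of_real: "scaleC (complex_of_real r) x = scaleR r x"
    and scaleC_add_right: "scaleC c (x + y) = scaleC c x + scaleC c y"
    and scaleC_add_left: "scaleC (c + d) x = scaleC c x + scaleC d x"
    and scaleC_scaleC: "scaleC c (scaleC d x) = scaleC (c * d) x"
    and scaleC_one: "scaleC 1 x = x"
    and cinner_commute: "cinner x y = cnj (cinner y x)"
    and cinner_add_left: "cinner (x + y) z = cinner x z + cinner y z"
    and cinner_scaleC_left: "cinner (scaleC c x) y = c * cinner x y"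
    and cinner_self_norm: "cinner x x = complex_of_real ((norm x)\<^sup>2)"

class chilbert_space = complex_inner_space + complete_space

instantiation complex :: complex_inner_space
begin
definition scaleC_complex :: "complex \<Rightarrow> complex \<Rightarrow> complex" where
  "scaleC_complex c x = c * x"
definition cinner_complex :: "complex \<Rightarrow> complex \<Rightarrow> complex" where
  "cinner_complex x y = x * cnj y"
instance
proof
  fix r :: real and x y z :: complex and c d :: complex
  show "scaleC (complex_of_real r) x = scaleR r x"
    by (simp add: scaleC_complex_def scaleR_conv_of_real)
  show "scaleC c (x + y) = scaleC c x + scaleC c y"
    by (simp add: scaleC_complex_def distrib_left)
  show "scaleC (c + d) x = scaleC c x + scaleC d x"
    by (simp add: scaleC_complex_def distrib_right)
  show "scaleC c (scaleC d x) = scaleC (c * d) x"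
    by (simp add: scaleC_complex_def mult.assoc)
  show "scaleC 1 x = x"
    by (simp add: scaleC_complex_def)
  show "cinner x y = cnj (cinner y x)"
    by (simp add: cinner_complex_def mult.commute)
  show "cinner (x + y) z = cinner x z + cinner y z"
    by (simp add: cinner_complex_def distrib_right)
  show "cinner (scaleC c x) y = c * cinner x y"
    by (simp add: cinner_complex_def scaleC_complex_def mult.assoc)
  show "cinner x x = complex_of_real ((norm x)\<^sup>2)"
    unfolding cinner_complex_def by (rule complex_norm_square[symmetric])
qed
end

instance complex :: chilbert_space ..

definition csubspace :: "'h::complex_inner_space set \<Rightarrow> bool" where
  "csubspace S \<longleftrightarrow> 0 \<in> S \<and> (\<forall>x\<in>S. \<forall>y\<in>S. x + y \<in> S) \<and> (\<forall>c. \<forall>x\<in>S. c *\<^sub>C x \<in> S)"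

definition cspan :: "'h::complex_inner_space set \<Rightarrow> 'h set" where
  "cspan S = {(\<Sum>x\<in>T. c x *\<^sub>C x) | T c. finite T \<and> T \<subseteq> S}"

definition cfinite_dim :: "'h::complex_inner_space set \<Rightarrow> bool" where
  "cfinite_dim N \<longleftrightarrow> (\<exists>S. finite S \<and> N \<subseteq> cspan S)"

definition lin_op :: "'h::complex_inner_space set \<Rightarrow> ('h \<Rightarrow> 'h) \<Rightarrow> bool" where
  "lin_op D A \<longleftrightarrow> csubspace D \<and>
     (\<forall>x\<in>D. \<forall>y\<in>D. A (x + y) = A x + A y) \<and> (\<forall>c. \<forall>x\<in>D. A (c *\<^sub>C x) = c *\<^sub>C A x)"

definition densely_defined :: "'h::complex_inner_space set \<Rightarrow> bool" where
  "densely_defined D \<longleftrightarrow> closure D = UNIV"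

definition closed_op :: "'h::complex_inner_space set \<Rightarrow> ('h \<Rightarrow> 'h) \<Rightarrow> bool" where
  "closed_op D A \<longleftrightarrow> lin_op D A \<and> closed {(x, A x) | x. x \<in> D}"

definition symmetric_op :: "'h::complex_inner_space set \<Rightarrow> ('h \<Rightarrow> 'h) \<Rightarrow> bool" where
  "symmetric_op D A \<longleftrightarrow> lin_op D A \<and> (\<forall>f\<in>D. \<forall>g\<in>D. cinner (A f) g = cinner f (A g))"

definition adjoint_graph :: "'h::complex_inner_space set \<Rightarrow> ('h \<Rightarrow> 'h) \<Rightarrow> ('h \<times> 'h) set" where
  "adjoint_graph D A = {(g, h). \<forall>f\<in>D. cinner (A f) g = cinner f h}"

definition defect_space :: "'h::complex_inner_space set \<Rightarrow> ('h \<Rightarrow> 'h) \<Rightarrow> complex \<Rightarrow> 'h set" where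
  "defect_space D A z = {g. (g, z *\<^sub>C g) \<in> adjoint_graph D A}"

definition finite_deficiency :: "'h::complex_inner_space set \<Rightarrow> ('h \<Rightarrow> 'h) \<Rightarrow> bool" where
  "finite_deficiency D A \<longleftrightarrow>
     cfinite_dim (defect_space D A \<i>) \<and> cfinite_dim (defect_space D A (- \<i>))"

definition dissipative :: "'h::complex_inner_space set \<Rightarrow> ('h \<Rightarrow> 'h) \<Rightarrow> bool" where
  "dissipative D A \<longleftrightarrow> lin_op D A \<and> (\<forall>f\<in>D. Im (cinner (A f) f) \<ge> 0)"

definition max_dissipative :: "'h::complex_inner_space set \<Rightarrow> ('h \<Rightarrow> 'h) \<Rightarrow> bool" where
  "max_dissipative D A \<longleftrightarrow> dissipative D A \<and>
     (\<forall>D2 A2. dissipative D2 A2 \<and> D \<subseteq> D2 \<and> (\<forall>f\<in>D. A2 f = A f) \<longrightarrow> D2 = D)"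

definition unitary :: "('h::complex_inner_space \<Rightarrow> 'h) \<Rightarrow> bool" where
  "unitary T \<longleftrightarrow> (\<forall>x y. T (x + y) = T x + T y) \<and> (\<forall>c x. T (c *\<^sub>C x) = c *\<^sub>C T x) \<and>
     surj T \<and> (\<forall>x y. cinner (T x) (T y) = cinner x y)"

definition cadjoint :: "('h::complex_inner_space \<Rightarrow> 'h) \<Rightarrow> 'h \<Rightarrow> 'h" where
  "cadjoint T y = (THE z. \<forall>x. cinner (T x) y = cinner x z)"

section \<open>The affine group: g(x) = a x + b with a > 0 is represented by the pair (a, b)\<close>

definition aff_group :: "(real \<times> real) set" where
  "aff_group = {g. fst g > 0}"

definition aff_comp :: "real \<times> real \<Rightarrow> real \<times> real \<Rightarrow> real \<times> real" where
  "aff_comp g h = (fst g * fst h, fst g * snd h + snd g)"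

definition aff_id :: "real \<times> real" where
  "aff_id = (1, 0)"

definition aff_inv :: "real \<times> real \<Rightarrow> real \<times> real" where
  "aff_inv g = (1 / fst g, - snd g / fst g)"

definition aff_ipow :: "real \<times> real \<Rightarrow> int \<Rightarrow> real \<times> real" where
  "aff_ipow g k = (if k \<ge> 0 then (aff_comp g ^^ nat k) aff_id
                   else (aff_comp (aff_inv g) ^^ nat (- k)) aff_id)"

definition cyclic_subgroup :: "(real \<times> real) set \<Rightarrow> bool" where
  "cyclic_subgroup G \<longleftrightarrow> (\<exists>g\<in>aff_group. G = range (aff_ipow g))"

definition one_param_subgroup :: "(real \<times> real) set \<Rightarrow> bool" where
  "one_param_subgroup G \<longleftrightarrow> (\<exists>\<phi>::real \<Rightarrow> real \<times> real.
     continuous_on UNIV \<phi> \<and> range \<phi> \<subseteq> aff_group \<and>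
     (\<forall>s t. \<phi> (s + t) = aff_comp (\<phi> s) (\<phi> t)) \<and> G = range \<phi>)"

definition unitary_rep :: "(real \<times> real) set \<Rightarrow> (real \<times> real \<Rightarrow> 'h::complex_inner_space \<Rightarrow> 'h) \<Rightarrow> bool" where
  "unitary_rep G U \<longleftrightarrow> (\<forall>g\<in>G. unitary (U g)) \<and> U aff_id = id \<and>
     (\<forall>g\<in>G. \<forall>h\<in>G. U (aff_comp g h) = U g \<circ> U h)"

definition strongly_continuous :: "(real \<times> real) set \<Rightarrow> (real \<times> real \<Rightarrow> 'h::complex_inner_space \<Rightarrow> 'h) \<Rightarrow> bool" where
  "strongly_continuous G U \<longleftrightarrow> (\<forall>f. continuous_on G (\<lambda>g. U g f))"

definition G_invariant :: "(real \<times> real) set \<Rightarrow> (real \<times> real \<Rightarrow> 'h::complex_inner_space \<Rightarrow> 'h)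
    \<Rightarrow> 'h set \<Rightarrow> ('h \<Rightarrow> 'h) \<Rightarrow> bool" where
  "G_invariant G U D A \<longleftrightarrow> (\<forall>g\<in>G. U g ` D = D \<and>
     (\<forall>f\<in>D. U g (A (cadjoint (U g) f)) = fst g *\<^sub>R A f + snd g *\<^sub>R f))"

end

theory Submission
  imports Defs "HOL-Computational_Algebra.Fundamental_Theorem_Algebra"
begin

text \<open>On \<open>H \<times> H\<close> consider the indefinite Hermitian form \<open>[(f, f'), (g, g')] = - \<i> ((f', g) - (f, g'))\<close>, for
  which \<open>[(f, f'), (f, f')] = 2 Im (f', f)\<close>. The graph \<open>S\<close> of the symmetric operator is neutral and its
  orthogonal complement is the graph \<open>R\<close> of the adjoint. A dissipative extension is a nonnegative
  subspace containing \<open>S\<close>; by the Cauchy-Schwarz inequality it is contained in \<open>R\<close>. So a maximal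
  dissipative extension is a maximal nonnegative subspace between \<open>S\<close> and \<open>R\<close>, and \<open>R / S\<close> is
  finite-dimensional by von Neumann's formula. The group acts on \<open>H \<times> H\<close> by commuting linear maps that
  multiply the form by positive constants and leave \<open>S\<close> and \<open>R\<close> invariant. A commuting family has a
  common eigenvector \<open>v\<close> modulo \<open>S\<close>, and an invariant maximal nonnegative subspace is found by
  induction on the dimension of \<open>R / S\<close>, replacing \<open>R\<close> by the orthogonal complement of \<open>v\<close> in \<open>R\<close>
  (and adjoining \<open>v\<close> to \<open>S\<close> when it is neutral).\<close>

section \<open>Invariant maximal nonnegative subspaces\<close>

locale complex_vector_space = vector_space scale
  for scale :: "complex \<Rightarrow> 'v::ab_group_add \<Rightarrow> 'v" (infixr \<open>\<odot>\<close> 75)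
begin

text \<open>For \<open>S \<subseteq> X \<subseteq> span (S \<union> B)\<close> the modular law gives \<open>X = S + X \<inter> span B\<close>; hence \<open>dim (X \<inter> span B)\<close>
  is a strictly monotone substitute for the dimension of \<open>X / S\<close> that avoids quotient spaces.\<close>

lemma dim_Int_span_less:
  assumes "finite B" and S: "subspace S" and X: "subspace X" and Y: "subspace Y"
    and "S \<subseteq> X" and "X \<subset> Y" and Y_le: "Y \<subseteq> span (S \<union> B)"
  shows "dim (X \<inter> span B) < dim (Y \<inter> span B)"
proof -
  have "\<exists>y \<in> Y \<inter> span B. y \<notin> X"
  proof -
    obtain z where z: "z \<in> Y" "z \<notin> X"
      using \<open>X \<subset> Y\<close> by blast
    then obtain s b where sb: "z = s + b" "s \<in> S" "b \<in> span B"
      using Y_le S unfolding span_Un by (auto simp: span_eq_iff[THEN iffD2])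
    have "s \<in> X" "s \<in> Y"
      using sb assms by auto
    then have "b \<in> Y" "b \<notin> X"
      using subspace_diff[OF Y z(1), of s] subspace_add[OF X, of s b] sb z by auto
    then show ?thesis
      using sb by blast
  qed
  then obtain y where y: "y \<in> Y" "y \<in> span B" "y \<notin> X"
    by blast
  obtain bX where bX: "bX \<subseteq> X \<inter> span B" "independent bX" "X \<inter> span B \<subseteq> span bX"
      "card bX = dim (X \<inter> span B)"
    using basis_exists by blast
  obtain bY where bY: "bY \<subseteq> Y \<inter> span B" "independent bY" "Y \<inter> span B \<subseteq> span bY"
      "card bY = dim (Y \<inter> span B)"
    using basis_exists by blast
  have "finite bY"
    using independent_span_bound[OF \<open>finite B\<close> bY(2)] bY(1) by blast
  have "span bX \<subseteq> X"
    using span_minimal bX(1) X by blast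
  then have "independent (insert y bX)"
    using y independent_insertI bX(2) by blast
  moreover have "insert y bX \<subseteq> span bY"
    using y bX(1) \<open>X \<subset> Y\<close> bY(3) by blast
  ultimately have "finite (insert y bX)" "card (insert y bX) \<le> card bY"
    using independent_span_bound[OF \<open>finite bY\<close>, of "insert y bX"] by simp_all
  moreover have "y \<notin> bX"
    using bX(1) y by blast
  ultimately show ?thesis
    using bX(4) bY(4) by simp
qed

lemma dim_Int_span_mono:
  assumes "finite B" and "subspace S" and "subspace X" and "subspace Y"
    and "S \<subseteq> X" and "X \<subseteq> Y" and "Y \<subseteq> span (S \<union> B)"
  shows "dim (X \<inter> span B) \<le> dim (Y \<inter> span B)"
  using dim_Int_span_less[of B S X Y] assms by (cases "X = Y") (auto simp: psubset_eq)

section \<open>Polynomials of a linear map and eigenvectors modulo a subspace\<close>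

definition poly_apply :: "('v \<Rightarrow> 'v) \<Rightarrow> complex poly \<Rightarrow> 'v \<Rightarrow> 'v" where
  "poly_apply W p v = fold_coeffs (\<lambda>c x. c \<odot> v + W x) p 0"

context
  fixes W
  assumes W: "Vector_Spaces.linear scale scale W"
begin

interpretation W: Vector_Spaces.linear scale scale W
  by (rule W)

lemma poly_apply_0 [simp]: "poly_apply W 0 v = 0"
  by (simp add: poly_apply_def)

lemma poly_apply_pCons [simp]: "poly_apply W (pCons c p) v = c \<odot> v + W (poly_apply W p v)"
  \<comment> \<open>\<open>pCons 0 0\<close> is the zero polynomial and has no coefficients to fold
    over; that case needs \<open>W 0 = 0\<close>. In all others the fold, which is Horner's scheme
    for \<open>p(W) v\<close>, unfolds once.\<close>
  by (cases "c = 0 \<and> p = 0") (auto simp: poly_apply_def W.zero)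

lemma poly_apply_add: "poly_apply W (p + q) v = poly_apply W p v + poly_apply W q v"
  by (induction p q rule: poly_induct2) (simp_all add: scale_left_distrib W.add algebra_simps)

lemma poly_apply_smult: "poly_apply W (smult c p) v = c \<odot> poly_apply W p v"
  by (induction p) (simp_all add: scale_right_distrib W.scale)

lemma poly_apply_linear_factor:
  "poly_apply W ([:- c, 1:] * p) v = W (poly_apply W p v) - c \<odot> poly_apply W p v"
proof -
  have "[:- c, 1:] * p = pCons 0 p + smult (- c) p"
    by simp
  then show ?thesis
    by (simp only: poly_apply_add poly_apply_smult) simp
qed

lemma poly_apply_in_subspace:
  assumes "subspace Y" and "W ` Y \<subseteq> Y" and "v \<in> Y"
  shows "poly_apply W p v \<in> Y"
  using assms by (induction p) (auto intro!: subspace_0 subspace_add subspace_scale)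

text \<open>Otherwise the spaces S + {p(W) v : deg p < k} would increase strictly with k between
  \<open>S\<close> and \<open>Y\<close>, and their intersections with \<open>span B\<close> would
  exceed dimension \<open>card B\<close>.\<close>

lemma exists_annihilating_poly:
  assumes "finite B" and S: "subspace S" and Y: "subspace Y" and "S \<subseteq> Y"
    and "Y \<subseteq> span (S \<union> B)" and WY: "W ` Y \<subseteq> Y" and v: "v \<in> Y"
  shows "\<exists>p. p \<noteq> 0 \<and> poly_apply W p v \<in> S"
proof (rule ccontr)
  assume none: "\<not> ?thesis"
  define E where "E k = {s + poly_apply W p v | s p. s \<in> S \<and> (\<forall>i\<ge>k. coeff p i = 0)}" for k
  have E_I: "s + poly_apply W p v \<in> E k" if "s \<in> S" "\<forall>i\<ge>k. coeff p i = 0" for s p k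
    unfolding E_def using that by blast
  have S_E: "S \<subseteq> E k" for k
    using E_I[where p = 0] by auto
  have E_sub: "subspace (E k)" for k
  proof (rule subspaceI)
    show "0 \<in> E k"
      using S_E subspace_0[OF S] by blast
  next
    fix x y assume "x \<in> E k" "y \<in> E k"
    then obtain s p t q where *: "x = s + poly_apply W p v" "y = t + poly_apply W q v" "s \<in> S" "t \<in> S"
        "\<forall>i\<ge>k. coeff p i = 0" "\<forall>i\<ge>k. coeff q i = 0"
      unfolding E_def by blast
    have "x + y = (s + t) + poly_apply W (p + q) v"
      by (simp add: * poly_apply_add)
    also have "\<dots> \<in> E k"
      by (rule E_I) (use * subspace_add[OF S] in auto)
    finally show "x + y \<in> E k" .
  next
    fix c x assume "x \<in> E k"
    then obtain s p where *: "x = s + poly_apply W p v" "s \<in> S" "\<forall>i\<ge>k. coeff p i = 0"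
      unfolding E_def by blast
    have "c \<odot> x = c \<odot> s + poly_apply W (smult c p) v"
      by (simp add: * poly_apply_smult scale_right_distrib)
    also have "\<dots> \<in> E k"
      by (rule E_I) (use * subspace_scale[OF S] in auto)
    finally show "c \<odot> x \<in> E k" .
  qed
  have E_Y: "E k \<subseteq> Y" for k
    unfolding E_def using \<open>S \<subseteq> Y\<close> poly_apply_in_subspace[OF Y WY v] subspace_add[OF Y] by blast
  have E_less: "E k \<subset> E (Suc k)" for k
  proof -
    have "E k \<subseteq> E (Suc k)"
      unfolding E_def using Suc_leD by blast
    moreover have "poly_apply W (monom 1 k) v \<in> E (Suc k)"
      using E_I[where s = 0 and p = "monom 1 k" and k = "Suc k"] subspace_0[OF S] by simp
    moreover have "poly_apply W (monom 1 k) v \<notin> E k"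
    proof
      assume "poly_apply W (monom 1 k) v \<in> E k"
      then obtain s p where *: "poly_apply W (monom 1 k) v = s + poly_apply W p v" "s \<in> S"
          "\<forall>i\<ge>k. coeff p i = 0"
        unfolding E_def by blast
      \<comment> \<open>The difference of X^k and \<open>p\<close> carries \<open>v\<close> into
        \<open>S\<close>, yet its coefficient at \<open>k\<close> is 1, so it would be an
        annihilating polynomial.\<close>
      have "poly_apply W (monom 1 k + smult (- 1) p) v = s"
        by (simp only: poly_apply_add poly_apply_smult) (simp add: *)
      moreover have "coeff (monom 1 k + smult (- 1) p) k \<noteq> 0"
        using * by simp
      then have "monom 1 k + smult (- 1) p \<noteq> 0"
        by force
      ultimately show False
        using none * by blast
    qed
    ultimately show ?thesis
      by blast
  qed
  have "k \<le> dim (E k \<inter> span B)" for k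
  proof (induction k)
    case (Suc k)
    have "dim (E k \<inter> span B) < dim (E (Suc k) \<inter> span B)"
      using dim_Int_span_less[OF \<open>finite B\<close> S E_sub E_sub S_E E_less] E_Y assms by blast
    then show ?case
      using Suc by simp
  qed simp
  then show False
    using dim_le_card[of "E (Suc (card B)) \<inter> span B" B] \<open>finite B\<close>
    by (metis Int_lower2 not_less_eq_eq order_trans)
qed

end

text \<open>Among all vectors x of \<open>Y\<close> outside \<open>S\<close> and nonzero p with p(W)
  x in \<open>S\<close>, take p of least degree. It is not constant, as x is outside
  \<open>S\<close>, so it has a root \<mu> and factors as (X - \<mu>) r. By minimality r(W) x is
  outside \<open>S\<close>, and it is the desired eigenvector modulo \<open>S\<close>.\<close>

lemma exists_eigenvector_mod:
  assumes W: "Vector_Spaces.linear scale scale W" and "finite B" and S: "subspace S" and Y: "subspace Y"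
    and "S \<subset> Y" and Y_le: "Y \<subseteq> span (S \<union> B)" and WY: "W ` Y \<subseteq> Y"
  shows "\<exists>\<mu>. \<exists>y\<in>Y - S. W y - \<mu> \<odot> y \<in> S"
proof -
  define P where "P n \<longleftrightarrow> (\<exists>p. \<exists>x\<in>Y - S. p \<noteq> 0 \<and> poly_apply W p x \<in> S \<and> degree p = n)" for n
  obtain x0 where "x0 \<in> Y - S"
    using \<open>S \<subset> Y\<close> by blast
  then have "\<exists>n. P n"
    unfolding P_def using exists_annihilating_poly[OF W \<open>finite B\<close> S Y _ Y_le WY, of x0] \<open>S \<subset> Y\<close> by blast
  then have P_Least: "P (LEAST n. P n)"
    by (rule LeastI_ex)
  then obtain p x where p: "p \<noteq> 0" "x \<in> Y" "x \<notin> S" "poly_apply W p x \<in> S" "degree p = (LEAST n. P n)"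
    unfolding P_def by blast
  have "degree p \<noteq> 0"
  proof
    assume "degree p = 0"
    then obtain c where c: "p = [:c:]"
      by (rule degree_eq_zeroE)
    have "W 0 = 0"
      using W by (rule Vector_Spaces.linear.axioms(3)[THEN module_hom.zero])
    then have "c \<odot> x \<in> S" "c \<noteq> 0"
      using p c W by (auto simp: poly_apply_pCons[OF W] poly_apply_0[OF W])
    then have "x \<in> S"
      using subspace_scale[OF S, of "c \<odot> x" "inverse c"] by simp
    then show False
      using p by blast
  qed
  then have "\<not> constant (poly p)"
    by (simp add: constant_degree)
  then obtain \<mu> where "poly p \<mu> = 0"
    using fundamental_theorem_of_algebra by blast
  then obtain r where r: "p = [:- \<mu>, 1:] * r"
    unfolding poly_eq_0_iff_dvd by (auto elim: dvdE)
  define y where "y = poly_apply W r x"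
  have "r \<noteq> 0"
    using r p by auto
  then have "degree p = Suc (degree r)"
    unfolding r by (subst degree_mult_eq) auto
  then have "\<not> P (degree r)"
    using p(5) not_less_Least[of "degree r" P] by simp
  then have "y \<notin> S"
    unfolding P_def y_def using \<open>r \<noteq> 0\<close> p by blast
  moreover have "y \<in> Y"
    unfolding y_def by (rule poly_apply_in_subspace[OF W Y WY p(2)])
  moreover have "W y - \<mu> \<odot> y \<in> S"
    using p(4) unfolding r y_def poly_apply_linear_factor[OF W] .
  ultimately show ?thesis
    by blast
qed

end

section \<open>Hermitian forms with a commuting family of symmetries\<close>

locale hermitian_form_symmetries = complex_vector_space scale
  for scale :: "complex \<Rightarrow> 'v::ab_group_add \<Rightarrow> 'v" (infixr \<open>\<odot>\<close> 75) +
  fixes form :: "'v \<Rightarrow> 'v \<Rightarrow> complex" and F :: "('v \<Rightarrow> 'v) set"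
  assumes form_add_left: "form (x + y) z = form x z + form y z"
    and form_scale_left: "form (c \<odot> x) z = c * form x z"
    and form_commute: "form x y = cnj (form y x)"
    and linear_F: "W \<in> F \<Longrightarrow> Vector_Spaces.linear scale scale W"
    and commute_F: "W \<in> F \<Longrightarrow> V \<in> F \<Longrightarrow> W (V x) = V (W x)"
    and inverse_F: "W \<in> F \<Longrightarrow> \<exists>V\<in>F. \<forall>x. V (W x) = x"
    and orthogonal_F: "W \<in> F \<Longrightarrow> form x y = 0 \<Longrightarrow> form (W x) (W y) = 0"
begin

text \<open>The maps in \<open>F\<close> commute and have left inverses in \<open>F\<close>, so the
  inclusion required here already forces equality.\<close>

definition invariant :: "'v set \<Rightarrow> bool" where
  "invariant X \<longleftrightarrow> (\<forall>W\<in>F. W ` X \<subseteq> X)"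

definition nonneg :: "'v set \<Rightarrow> bool" where
  "nonneg X \<longleftrightarrow> (\<forall>x\<in>X. Re (form x x) \<ge> 0)"

lemma form_add_right: "form x (y + z) = form x y + form x z"
  by (metis form_commute form_add_left complex_cnj_add)

lemma form_scale_right: "form x (c \<odot> y) = cnj c * form x y"
  by (metis form_commute form_scale_left complex_cnj_mult)

lemma form_diff_left: "form (x - y) z = form x z - form y z"
  by (metis add_diff_cancel_right' diff_add_cancel form_add_left)

lemma form_eq_0_commute: "form x y = 0 \<longleftrightarrow> form y x = 0"
  by (metis form_commute complex_cnj_zero)

lemma form_self: "form x x = of_real (Re (form x x))"
  by (metis form_commute complex_cnj_cancel_iff Reals_cnj_iff of_real_Re)

text \<open>A degenerate Cauchy-Schwarz inequality: since \<open>v\<close> is neutral, the value of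
  the form at x + c v is its value at x plus a term real-linear in c, which is unbounded below
  unless x and v are orthogonal.\<close>

lemma nonneg_neutral_orthogonal:
  assumes L: "subspace L" "nonneg L" and "v \<in> L" "x \<in> L" and v: "form v v = 0"
  shows "form x v = 0"
proof (rule ccontr)
  define w where "w = form x v"
  assume "form x v \<noteq> 0"
  then have w: "(cmod w)\<^sup>2 > 0"
    by (simp add: w_def)
  \<comment> \<open>Chosen so that the form takes exactly the value -1 at x + c v.\<close>
  define t where "t = (Re (form x x) + 1) / (2 * (cmod w)\<^sup>2)"
  define c where "c = - of_real t * w"
  have "x + c \<odot> v \<in> L"
    using assms subspace_add subspace_scale by blast
  then have "0 \<le> Re (form (x + c \<odot> v) (x + c \<odot> v))"
    using L(2) unfolding nonneg_def by blast
  also have "form (x + c \<odot> v) (x + c \<odot> v) = form x x + cnj c * w + c * cnj w"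
    by (simp add: form_add_left form_add_right form_scale_left form_scale_right v
      w_def form_commute[of v x] algebra_simps)
  also have "\<dots> = form x x - of_real (2 * t * (cmod w)\<^sup>2)"
    unfolding c_def using complex_norm_square[of w] by (simp add: algebra_simps)
  also have "Re \<dots> = Re (form x x) - 2 * t * (cmod w)\<^sup>2"
    by simp
  also have "\<dots> = - 1"
    unfolding t_def using w by (simp add: field_simps)
  finally show False
    by simp
qed

text \<open>Take an invariant \<open>E\<close> strictly above \<open>S\<close> and inside
  \<open>R\<close> of least dimension modulo \<open>S\<close>. For each W the vectors of
  \<open>E\<close> that are eigenvectors modulo \<open>S\<close> for a suitable \<mu> form a
  subspace strictly above \<open>S\<close>, invariant by commutativity, hence equal to
  \<open>E\<close>. So every vector of \<open>E\<close> outside \<open>S\<close> serves all of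
  \<open>F\<close> at once, with \<mu> depending on W; \<open>F\<close> may be infinite.\<close>

lemma common_eigenvector_mod:
  assumes "finite B" and S: "subspace S" "invariant S" and R: "subspace R" "invariant R"
    and "S \<subset> R" and R_le: "R \<subseteq> span (S \<union> B)"
  shows "\<exists>v\<in>R - S. \<forall>W\<in>F. \<exists>\<mu>. W v - \<mu> \<odot> v \<in> S"
proof -
  define Q where "Q E \<longleftrightarrow> subspace E \<and> invariant E \<and> S \<subset> E \<and> E \<subseteq> R" for E
  have "Q R"
    using assms by (simp add: Q_def)
  then obtain E where E: "Q E" and E_min: "\<And>E'. Q E' \<Longrightarrow> dim (E \<inter> span B) \<le> dim (E' \<inter> span B)"
    using ex_has_least_nat[of Q R "\<lambda>E. dim (E \<inter> span B)"] by blast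
  have E_sub: "subspace E" "invariant E" "S \<subset> E" "E \<subseteq> R"
    using E by (auto simp: Q_def)
  obtain v where v: "v \<in> E" "v \<notin> S"
    using E_sub by blast
  have "\<exists>\<mu>. W v - \<mu> \<odot> v \<in> S" if W: "W \<in> F" for W
  proof -
    interpret W: Vector_Spaces.linear scale scale W
      by (rule linear_F[OF W])
    have "E \<subseteq> span (S \<union> B)" "W ` E \<subseteq> E"
      using E_sub R_le W by (auto simp: invariant_def)
    then obtain \<mu> y where y: "y \<in> E" "y \<notin> S" "W y - \<mu> \<odot> y \<in> S"
      using exists_eigenvector_mod[OF linear_F[OF W] \<open>finite B\<close> S(1) E_sub(1,3)] by blast
    define E' where "E' = {x \<in> E. W x - \<mu> \<odot> x \<in> S}"
    have "subspace E'"
    proof (rule subspaceI)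
      show "0 \<in> E'"
        by (simp add: E'_def W.zero subspace_0 E_sub(1) S(1))
      show "a + b \<in> E'" if "a \<in> E'" "b \<in> E'" for a b
      proof -
        have "W (a + b) - \<mu> \<odot> (a + b) = (W a - \<mu> \<odot> a) + (W b - \<mu> \<odot> b)"
          by (simp add: W.add scale_right_distrib)
        then show ?thesis
          using that by (simp add: E'_def subspace_add E_sub(1) S(1))
      qed
      show "c \<odot> a \<in> E'" if "a \<in> E'" for c a
      proof -
        have "W (c \<odot> a) - \<mu> \<odot> (c \<odot> a) = c \<odot> (W a - \<mu> \<odot> a)"
          by (simp add: W.scale scale_right_diff_distrib mult.commute)
        then show ?thesis
          using that by (simp add: E'_def subspace_scale E_sub(1) S(1))
      qed
    qed
    moreover have "invariant E'"
      unfolding invariant_def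
    proof (intro ballI subsetI)
      fix V x assume V: "V \<in> F" and "x \<in> V ` E'"
      then obtain e where e: "x = V e" "e \<in> E" "W e - \<mu> \<odot> e \<in> S"
        by (auto simp: E'_def)
      interpret V: Vector_Spaces.linear scale scale V
        by (rule linear_F[OF V])
      have "W (V e) - \<mu> \<odot> V e = V (W e - \<mu> \<odot> e)"
        by (simp add: V.diff V.scale commute_F[OF W V])
      moreover have "V (W e - \<mu> \<odot> e) \<in> S" "V e \<in> E"
        using e S(2) E_sub(2) V unfolding invariant_def by blast+
      ultimately show "x \<in> E'"
        using e by (simp add: E'_def)
    qed
    moreover have "S \<subset> E'"
    proof -
      have "S \<subseteq> E'"
        using E_sub(3) S W unfolding E'_def invariant_def
        by (auto intro!: subspace_diff subspace_scale)
      moreover have "y \<in> E'"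
        using y by (simp add: E'_def)
      ultimately show ?thesis
        using y by blast
    qed
    moreover have "E' \<subseteq> R"
      using E_sub by (auto simp: E'_def)
    ultimately have "Q E'"
      by (simp add: Q_def)
    have "E' = E"
    proof (rule ccontr)
      assume "E' \<noteq> E"
      then have "E' \<subset> E"
        by (auto simp: E'_def)
      then have "dim (E' \<inter> span B) < dim (E \<inter> span B)"
        using dim_Int_span_less[OF \<open>finite B\<close> S(1)] \<open>Q E'\<close> E_sub R_le unfolding Q_def by blast
      then show False
        using E_min[OF \<open>Q E'\<close>] by simp
    qed
    then show ?thesis
      using v by (auto simp: E'_def)
  qed
  then show ?thesis
    using v E_sub by blast
qed

section \<open>Adjoining an eigenvector and passing to its orthogonal complement\<close>

definition adjoin :: "'v set \<Rightarrow> 'v \<Rightarrow> 'v set" where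
  "adjoin X v = {x + c \<odot> v | x c. x \<in> X}"

lemma subspace_adjoin:
  assumes "subspace X"
  shows "subspace (adjoin X v)"
proof (rule subspaceI)
  show "0 \<in> adjoin X v"
    unfolding adjoin_def using subspace_0[OF assms] by (force intro!: exI[of _ 0])
  show "a + b \<in> adjoin X v" if "a \<in> adjoin X v" "b \<in> adjoin X v" for a b
  proof -
    from that obtain x c y d where *: "a = x + c \<odot> v" "b = y + d \<odot> v" "x \<in> X" "y \<in> X"
      unfolding adjoin_def by blast
    have "a + b = (x + y) + (c + d) \<odot> v"
      by (simp add: * scale_left_distrib)
    then show ?thesis
      unfolding adjoin_def using * subspace_add[OF assms] by blast
  qed
  show "k \<odot> a \<in> adjoin X v" if "a \<in> adjoin X v" for k a
  proof -
    from that obtain x c where *: "a = x + c \<odot> v" "x \<in> X"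
      unfolding adjoin_def by blast
    have "k \<odot> a = k \<odot> x + (k * c) \<odot> v"
      by (simp add: * scale_right_distrib)
    then show ?thesis
      unfolding adjoin_def using * subspace_scale[OF assms] by blast
  qed
qed

lemma subset_adjoin: "X \<subseteq> adjoin X v"
proof
  fix x assume "x \<in> X"
  then have "x = x + 0 \<odot> v \<and> x \<in> X"
    by simp
  then show "x \<in> adjoin X v"
    unfolding adjoin_def by blast
qed

lemma in_adjoin: "subspace X \<Longrightarrow> v \<in> adjoin X v"
  unfolding adjoin_def using subspace_0[of X] scale_one[of v] by (metis (mono_tags, lifting) add_0 mem_Collect_eq)

lemma adjoin_subset:
  "X \<subseteq> Y \<Longrightarrow> v \<in> Y \<Longrightarrow> subspace Y \<Longrightarrow> adjoin X v \<subseteq> Y"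
  unfolding adjoin_def by (auto intro!: subspace_add subspace_scale)

lemma invariant_adjoin:
  assumes X: "subspace X" "invariant X" and v: "\<And>W. W \<in> F \<Longrightarrow> \<exists>\<mu>. W v - \<mu> \<odot> v \<in> X"
  shows "invariant (adjoin X v)"
  unfolding invariant_def
proof (intro ballI subsetI)
  fix W y assume W: "W \<in> F" and "y \<in> W ` adjoin X v"
  then obtain x c where y: "y = W (x + c \<odot> v)" "x \<in> X"
    by (auto simp: adjoin_def)
  interpret W: Vector_Spaces.linear scale scale W
    by (rule linear_F[OF W])
  obtain \<mu> where "W v - \<mu> \<odot> v \<in> X"
    using v[OF W] by blast
  moreover have "W x \<in> X"
    using X W y by (auto simp: invariant_def)
  ultimately have "W x + c \<odot> (W v - \<mu> \<odot> v) \<in> X"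
    using X by (intro subspace_add subspace_scale) auto
  moreover have "y = (W x + c \<odot> (W v - \<mu> \<odot> v)) + (c * \<mu>) \<odot> v"
    by (simp add: y W.add W.scale scale_right_diff_distrib)
  ultimately show "y \<in> adjoin X v"
    unfolding adjoin_def by blast
qed

lemma subspace_orthogonal:
  assumes "subspace R"
  shows "subspace {x \<in> R. form x v = 0}"
proof (rule subspaceI)
  show "0 \<in> {x \<in> R. form x v = 0}"
    using subspace_0[OF assms] form_scale_left[of 0 0 v] by simp
qed (use assms in \<open>auto simp: form_add_left form_scale_left subspace_add subspace_scale\<close>)

text \<open>If x is orthogonal to v, then W x is orthogonal to W v, which is \<mu> v up to an
  element of \<open>S\<close>, and \<open>S\<close> is orthogonal to \<open>R\<close>. Hence W x is
  orthogonal to v once \<mu> is nonzero. For \<mu> = 0 the vector W v would lie in \<open>S\<close>,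
  and the inverse of W would bring v back into \<open>S\<close>.\<close>

lemma invariant_orthogonal:
  assumes S: "subspace S" "invariant S" and R: "invariant R"
    and SR: "\<And>x y. x \<in> S \<Longrightarrow> y \<in> R \<Longrightarrow> form x y = 0"
    and v: "v \<notin> S" "\<And>W. W \<in> F \<Longrightarrow> \<exists>\<mu>. W v - \<mu> \<odot> v \<in> S"
  shows "invariant {x \<in> R. form x v = 0}"
  unfolding invariant_def
proof (intro ballI subsetI)
  fix W y assume W: "W \<in> F" and "y \<in> W ` {x \<in> R. form x v = 0}"
  then obtain x where x: "y = W x" "x \<in> R" "form x v = 0"
    by auto
  have "W x \<in> R"
    using x R W by (auto simp: invariant_def)
  obtain \<mu> where \<mu>: "W v - \<mu> \<odot> v \<in> S"
    using v(2)[OF W] by blast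
  have "\<mu> \<noteq> 0"
  proof
    assume "\<mu> = 0"
    then have "W v \<in> S"
      using \<mu> by simp
    moreover obtain V where "V \<in> F" "\<forall>x. V (W x) = x"
      using inverse_F[OF W] by blast
    ultimately show False
      using S(2) v(1) unfolding invariant_def by (metis image_subset_iff)
  qed
  have "form (W x) (W v - \<mu> \<odot> v) = 0"
    using SR[OF \<mu> \<open>W x \<in> R\<close>] by (simp add: form_eq_0_commute)
  moreover have "form (W x) (W v) = 0"
    using orthogonal_F[OF W x(3)] .
  moreover have "form (W x) (W v) = form (W x) (W v - \<mu> \<odot> v) + cnj \<mu> * form (W x) v"
    by (simp add: form_add_right[symmetric] form_scale_right[symmetric])
  ultimately show "y \<in> {x \<in> R. form x v = 0}"
    using \<open>\<mu> \<noteq> 0\<close> \<open>W x \<in> R\<close> x by simp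
qed

text \<open>Maximality is tested only inside \<open>R\<close>, so that the induction can shrink
  \<open>R\<close>. That this suffices for maximality among all dissipative operators is shown at
  the end.\<close>

definition maximal_nonneg_in :: "'v set \<Rightarrow> 'v set \<Rightarrow> bool" where
  "maximal_nonneg_in R M \<longleftrightarrow> subspace M \<and> nonneg M \<and> M \<subseteq> R \<and>
     (\<forall>L. subspace L \<and> nonneg L \<and> M \<subseteq> L \<and> L \<subseteq> R \<longrightarrow> L = M)"

lemma orthogonal_decomposition:
  assumes "form v v \<noteq> 0"
  shows "form (x - (form x v / form v v) \<odot> v) v = 0"
  using assms by (simp add: form_diff_left form_scale_left)

lemma form_self_orthogonal_add:
  assumes "form x v = 0"
  shows "Re (form (x + c \<odot> v) (x + c \<odot> v)) = Re (form x x) + (cmod c)\<^sup>2 * Re (form v v)"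
proof -
  have "form v x = 0"
    using assms by (simp add: form_eq_0_commute)
  then have "form (x + c \<odot> v) (x + c \<odot> v) = form x x + (c * cnj c) * form v v"
    using assms by (simp add: form_add_left form_add_right form_scale_left form_scale_right)
  then show ?thesis
    by (simp add: complex_norm_square[symmetric] flip: of_real_power)
qed

text \<open>\<open>S0\<close> and \<open>B\<close> stay fixed while \<open>S\<close> and
  \<open>R\<close> vary, so all dimensions are measured inside the same \<open>span B\<close>; the
  induction measure is the dimension of R / S. With a common eigenvector v and a solution M for its
  orthogonal complement \<open>R'\<close>, there are three cases: for neutral v, which is first
  adjoined to \<open>S\<close>, and for negative v, M itself is maximal in \<open>R\<close>; for
  positive v, M with v adjoined is.\<close>

lemma exists_invariant_maximal_nonneg_aux:
  assumes "finite B" and S0: "subspace S0" and "S0 \<subseteq> S" and S: "subspace S" "invariant S"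
    and R: "subspace R" "invariant R" and "S \<subseteq> R" and R_le: "R \<subseteq> span (S0 \<union> B)"
    and SR: "\<And>x y. x \<in> S \<Longrightarrow> y \<in> R \<Longrightarrow> form x y = 0"
  shows "\<exists>M. maximal_nonneg_in R M \<and> invariant M \<and> S \<subseteq> M"
  using assms(3-)
proof (induction "dim (R \<inter> span B) - dim (S \<inter> span B)" arbitrary: S R rule: less_induct)
  case less
  note S = less.prems(2,3) and R = less.prems(4,5) and SR = less.prems(8)
  show ?case
  proof (cases "S = R")
    case True
    then show ?thesis
      using S R SR by (intro exI[of _ S]) (auto simp: maximal_nonneg_in_def nonneg_def)
  next
    case False
    then have "S \<subset> R"
      using less.prems by blast
    have "span (S0 \<union> B) \<subseteq> span (S \<union> B)"
      using less.prems(1) by (intro span_mono) auto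
    then obtain v where v: "v \<in> R" "v \<notin> S" and ev: "\<And>W. W \<in> F \<Longrightarrow> \<exists>\<mu>. W v - \<mu> \<odot> v \<in> S"
      using common_eigenvector_mod[OF \<open>finite B\<close> S R \<open>S \<subset> R\<close>] less.prems(7) by blast
    define R' where "R' = {x \<in> R. form x v = 0}"
    have R': "subspace R'" "invariant R'"
      unfolding R'_def by (rule subspace_orthogonal[OF R(1)], rule invariant_orthogonal[OF S R(2)])
        (use SR v ev in auto)
    have "S \<subseteq> R'" "R' \<subseteq> R"
      unfolding R'_def using SR v less.prems(6) by auto
    have dims: "dim (S \<inter> span B) < dim (R \<inter> span B)" "dim (R' \<inter> span B) \<le> dim (R \<inter> span B)"
      using dim_Int_span_less[OF \<open>finite B\<close> S0 S(1) R(1)] dim_Int_span_mono[OF \<open>finite B\<close> S0 R'(1) R(1)]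
        \<open>S \<subset> R\<close> \<open>S \<subseteq> R'\<close> \<open>R' \<subseteq> R\<close> less.prems by auto
    show ?thesis
    proof (cases "form v v = 0")
      case True
      define S' where "S' = adjoin S v"
      have S': "subspace S'" "invariant S'" "S \<subset> S'"
        unfolding S'_def
        using subspace_adjoin[OF S(1)] invariant_adjoin[OF S, of v] ev subset_adjoin[of S v]
          in_adjoin[OF S(1), of v] v(2) by auto
      have "S' \<subseteq> R"
        unfolding S'_def by (rule adjoin_subset) (use less.prems v in auto)
      \<comment> \<open>A neutral v may be orthogonal to all of \<open>R\<close>, so that
        \<open>R' = R\<close>; the measure drops because \<open>S\<close> grows.\<close>
      have "dim (S \<inter> span B) < dim (S' \<inter> span B)"
        using dim_Int_span_less[OF \<open>finite B\<close> S0 S(1) S'(1)] S'(3) \<open>S' \<subseteq> R\<close> less.prems by blast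
      then have "dim (R' \<inter> span B) - dim (S' \<inter> span B) < dim (R \<inter> span B) - dim (S \<inter> span B)"
        using dims by linarith
      moreover have "S' \<subseteq> R'"
        unfolding S'_def by (rule adjoin_subset) (use \<open>S \<subseteq> R'\<close> R' v True in \<open>auto simp: R'_def\<close>)
      moreover have "form x y = 0" if "x \<in> S'" "y \<in> R'" for x y
        using that SR by (auto simp: S'_def adjoin_def R'_def form_add_left form_scale_left form_eq_0_commute[of v])
      moreover have "S0 \<subseteq> S'" "R' \<subseteq> span (S0 \<union> B)"
        using S'(3) \<open>R' \<subseteq> R\<close> less.prems by blast+
      ultimately obtain M where M: "maximal_nonneg_in R' M" "invariant M" "S' \<subseteq> M"
        using less.hyps[of R' S'] S'(1,2) R' by blast
      \<comment> \<open>A nonnegative competitor contains the neutral v, is therefore orthogonal to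
        it, and so already lies in \<open>R'\<close>, where M is maximal.\<close>
      have "L \<subseteq> R'" if "subspace L" "nonneg L" "M \<subseteq> L" "L \<subseteq> R" for L
        using nonneg_neutral_orthogonal[OF that(1,2) _ _ True] that M(3) in_adjoin[OF S(1)]
        unfolding R'_def S'_def by blast
      then have "maximal_nonneg_in R M"
        using M(1) \<open>R' \<subseteq> R\<close> unfolding maximal_nonneg_in_def by blast
      then show ?thesis
        using M S'(3) by blast
    next
      \<comment> \<open>Now v is not in \<open>R'\<close>, so the measure drops because
        \<open>R\<close> shrinks while \<open>S\<close> is kept.\<close>
      case nz: False
      then have "v \<notin> R'"
        by (simp add: R'_def)
      then have "dim (R' \<inter> span B) < dim (R \<inter> span B)"
        using dim_Int_span_less[OF \<open>finite B\<close> S0 R'(1) R(1)] \<open>S \<subseteq> R'\<close> \<open>R' \<subseteq> R\<close> v less.prems by blast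
      then have "dim (R' \<inter> span B) - dim (S \<inter> span B) < dim (R \<inter> span B) - dim (S \<inter> span B)"
        using dims by linarith
      moreover have "form x y = 0" if "x \<in> S" "y \<in> R'" for x y
        using that SR \<open>R' \<subseteq> R\<close> by blast
      moreover have "R' \<subseteq> span (S0 \<union> B)"
        using \<open>R' \<subseteq> R\<close> less.prems by blast
      ultimately obtain M where M: "maximal_nonneg_in R' M" "invariant M" "S \<subseteq> M"
        using less.hyps[of R' S] S R' \<open>S \<subseteq> R'\<close> less.prems(1) by blast
      have M_sub: "subspace M" "nonneg M" "M \<subseteq> R'"
        and M_max: "\<And>L. subspace L \<Longrightarrow> nonneg L \<Longrightarrow> M \<subseteq> L \<Longrightarrow> L \<subseteq> R' \<Longrightarrow> L = M"
        using M(1) unfolding maximal_nonneg_in_def by blast+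
      have M_v: "form x v = 0" if "x \<in> M" for x
        using M_sub that by (auto simp: R'_def)
      show ?thesis
      proof (cases "Re (form v v) > 0")
        case pos: True
        define N where "N = adjoin M v"
        have "invariant N"
          unfolding N_def using invariant_adjoin[OF M_sub(1) M(2)] ev M(3) by blast
        moreover have "S \<subseteq> N"
          unfolding N_def using M(3) subset_adjoin by blast
        moreover have "maximal_nonneg_in R N"
          unfolding maximal_nonneg_in_def
        proof (intro conjI allI impI)
          show "subspace N"
            unfolding N_def using M_sub by (intro subspace_adjoin)
          show "N \<subseteq> R"
            unfolding N_def by (rule adjoin_subset) (use M_sub \<open>R' \<subseteq> R\<close> v R in auto)
          show "nonneg N"
            unfolding nonneg_def N_def adjoin_def
            using M_sub(2) pos by (auto simp: form_self_orthogonal_add M_v nonneg_def)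
          fix L assume L: "subspace L \<and> nonneg L \<and> N \<subseteq> L \<and> L \<subseteq> R"
          have "v \<in> L" "M \<subseteq> L"
            using L in_adjoin[OF M_sub(1), of v] subset_adjoin[of M v] unfolding N_def by blast+
          \<comment> \<open>Since v lies in \<open>L\<close>, projecting along v maps
            \<open>L\<close> into this intersection; thus \<open>L\<close> is M with v
            adjoined.\<close>
          have "L \<inter> R' = M"
            using L R' M_sub(3) \<open>M \<subseteq> L\<close> by (intro M_max subspace_inter) (auto simp: nonneg_def)
          have "L \<subseteq> N"
          proof
            fix x assume "x \<in> L"
            define c where "c = form x v / form v v"
            have "x - c \<odot> v \<in> L"
              using L \<open>x \<in> L\<close> \<open>v \<in> L\<close> by (intro subspace_diff subspace_scale) auto
            then have "x - c \<odot> v \<in> M"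
              using orthogonal_decomposition[OF nz, of x] L \<open>L \<inter> R' = M\<close> by (auto simp: R'_def c_def)
            then show "x \<in> N"
              unfolding N_def adjoin_def by (force intro!: exI[of _ "x - c \<odot> v"])
          qed
          then show "L = N"
            using L by blast
        qed
        ultimately show ?thesis
          by blast
      next
        case False
        \<comment> \<open>The form is real on the diagonal, so nonzero and not positive means
          negative.\<close>
        then have neg: "Re (form v v) < 0"
          using nz form_self[of v] by (cases "Re (form v v) = 0") auto
        have "maximal_nonneg_in R M"
          unfolding maximal_nonneg_in_def
        proof (intro conjI allI impI)
          fix L assume L: "subspace L \<and> nonneg L \<and> M \<subseteq> L \<and> L \<subseteq> R"
          \<comment> \<open>Projecting a nonnegative subspace along the negative vector keeps it nonnegative.\<close>
          define L' where "L' = adjoin L v \<inter> R'"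
          have proj: "\<exists>c. x + c \<odot> v \<in> L" if "x \<in> L'" for x
          proof -
            from that obtain y c where "x = y + c \<odot> v" "y \<in> L"
              by (auto simp: L'_def adjoin_def)
            then show ?thesis
              by (intro exI[of _ "- c"]) simp
          qed
          have "L' = M"
          proof (rule M_max)
            show "subspace L'"
              unfolding L'_def using L R' by (intro subspace_inter subspace_adjoin) auto
            show "nonneg L'"
              unfolding nonneg_def
            proof
              fix x assume x: "x \<in> L'"
              then obtain c where "x + c \<odot> v \<in> L"
                using proj by blast
              then have "0 \<le> Re (form (x + c \<odot> v) (x + c \<odot> v))"
                using L by (auto simp: nonneg_def)
              also have "\<dots> = Re (form x x) + (cmod c)\<^sup>2 * Re (form v v)"
                using x by (intro form_self_orthogonal_add) (auto simp: L'_def R'_def)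
              also have "\<dots> \<le> Re (form x x)"
                using neg by (simp add: mult_nonneg_nonpos)
              finally show "0 \<le> Re (form x x)" .
            qed
            show "M \<subseteq> L'" "L' \<subseteq> R'"
              unfolding L'_def using L M_sub subset_adjoin by blast+
          qed
          have "x \<in> M" if "x \<in> L" for x
          proof -
            define c where "c = form x v / form v v"
            have "x - c \<odot> v \<in> R'"
              using orthogonal_decomposition[OF nz, of x] L that v R
              unfolding R'_def c_def by (auto intro!: subspace_diff subspace_scale)
            moreover have "x - c \<odot> v \<in> adjoin L v"
              unfolding adjoin_def using that by (force intro!: exI[of _ x] exI[of _ "- c"])
            ultimately have "x - c \<odot> v \<in> M"
              using \<open>L' = M\<close> by (auto simp: L'_def)
            \<comment> \<open>Since M is contained in \<open>L\<close>, the vector c v lies in the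
              nonnegative \<open>L\<close>. As v is negative, c = 0 and x itself is in M.\<close>
            then have "x - (x - c \<odot> v) \<in> L"
              using L subspace_diff[of L x "x - c \<odot> v"] that by blast
            then have "0 \<le> Re (form (0 + c \<odot> v) (0 + c \<odot> v))"
              using L by (simp add: nonneg_def)
            also have "\<dots> = (cmod c)\<^sup>2 * Re (form v v)"
              using form_scale_left[of 0 0 v] form_scale_left[of 0 0 0]
              by (subst form_self_orthogonal_add) simp_all
            finally have "c = 0"
              using neg by (simp add: zero_le_mult_iff)
            then show "x \<in> M"
              using \<open>x - c \<odot> v \<in> M\<close> by simp
          qed
          then show "L = M"
            using L by blast
        qed (use M_sub \<open>R' \<subseteq> R\<close> in auto)
        then show ?thesis
          using M by blast
      qed
    qed
  qed
qed

theorem exists_invariant_maximal_nonneg: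
  assumes "finite B" and "subspace S" "invariant S" and "subspace R" "invariant R"
    and "S \<subseteq> R" and "R \<subseteq> span (S \<union> B)"
    and "\<And>x y. x \<in> S \<Longrightarrow> y \<in> R \<Longrightarrow> form x y = 0"
  shows "\<exists>M. maximal_nonneg_in R M \<and> invariant M \<and> S \<subseteq> M"
  by (rule exists_invariant_maximal_nonneg_aux[OF assms(1,2) order_refl assms(2-7)]) (fact assms(8))

end

section \<open>Operators and their graphs\<close>

interpretation scaleC: complex_vector_space "scaleC :: complex \<Rightarrow> 'a::complex_inner_space \<Rightarrow> 'a"
  by unfold_locales (simp_all add: scaleC_add_right scaleC_add_left scaleC_scaleC scaleC_one)

lemma csubspace_iff_subspace: "csubspace S \<longleftrightarrow> scaleC.subspace S"
  by (auto simp: csubspace_def scaleC.subspace_def)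

lemma cspan_subset_span: "cspan S \<subseteq> scaleC.span S"
  by (auto simp: cspan_def intro!: scaleC.span_sum scaleC.span_scale intro: scaleC.span_base)

lemma cinner_add_right: "cinner x (y + z) = cinner x y + cinner x z"
  by (metis cinner_commute cinner_add_left complex_cnj_add)

lemma cinner_scaleC_right: "cinner x (scaleC c y) = cnj c * cinner x y"
  by (metis cinner_commute cinner_scaleC_left complex_cnj_mult)

lemma cinner_diff_left: "cinner (x - y) z = cinner x z - cinner y z"
  by (metis add_diff_cancel_right' diff_add_cancel cinner_add_left)

lemma cinner_diff_right: "cinner x (y - z) = cinner x y - cinner x z"
  by (metis add_diff_cancel_right' diff_add_cancel cinner_add_right)

lemma cinner_zero_left [simp]: "cinner 0 x = 0"
  using cinner_diff_left[of 0 0 x] by simp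

lemma cinner_zero_right [simp]: "cinner x 0 = 0"
  using cinner_diff_right[of x 0 0] by simp

lemma cinner_minus_right: "cinner x (- y) = - cinner x y"
  using cinner_diff_right[of x 0 y] by simp

lemma cinner_scaleR_left: "cinner (r *\<^sub>R x) y = of_real r * cinner x y"
  unfolding scaleC_of_real[symmetric] by (rule cinner_scaleC_left)

lemma cinner_scaleR_right: "cinner x (r *\<^sub>R y) = of_real r * cinner x y"
  unfolding scaleC_of_real[symmetric] by (simp add: cinner_scaleC_right)

lemma cinner_self_eq_0 [simp]: "cinner x x = 0 \<longleftrightarrow> x = 0"
  by (simp add: cinner_self_norm)

lemma cinner_right_eqI:
  assumes "\<And>x. cinner x y = cinner x z"
  shows "y = z"
  using assms[of "y - z"] cinner_diff_right[of "y - z" y z] by simp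

lemma norm_add_squared: "(norm (x + y))\<^sup>2 = (norm x)\<^sup>2 + 2 * Re (cinner x y) + (norm y)\<^sup>2"
proof -
  have "Re (cinner (x + y) (x + y)) = Re (cinner x x) + (Re (cinner x y) + Re (cinner y x)) + Re (cinner y y)"
    by (simp add: cinner_add_left cinner_add_right)
  moreover have "Re (cinner y x) = Re (cinner x y)"
    by (subst cinner_commute) simp
  ultimately show ?thesis
    by (simp add: cinner_self_norm)
qed

lemma norm_diff_squared: "(norm (x - y))\<^sup>2 = (norm x)\<^sup>2 - 2 * Re (cinner x y) + (norm y)\<^sup>2"
  using norm_add_squared[of x "- y"] by (simp add: cinner_minus_right)

text \<open>By Pythagoras no vector of \<open>D\<close> is closer to h than 0 is, which contradicts
  density unless h = 0.\<close>

lemma densely_defined_orthogonal_eq_0: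
  assumes "densely_defined D" and orth: "\<And>x. x \<in> D \<Longrightarrow> cinner x h = 0"
  shows "h = 0"
proof (rule ccontr)
  assume "h \<noteq> 0"
  moreover have "h \<in> closure D"
    using assms(1) by (simp add: densely_defined_def)
  ultimately obtain x where x: "x \<in> D" "dist x h < norm h"
    unfolding closure_approachable by (metis zero_less_norm_iff)
  have "(norm h)\<^sup>2 \<le> (norm (x - h))\<^sup>2"
    using norm_diff_squared[of x h] orth[OF x(1)] by simp
  then show False
    using x(2) by (simp add: dist_norm)
qed

text \<open>The classical argument: a sequence in \<open>S\<close> minimizing the distance to x is
  Cauchy by the parallelogram law, and the residual at its limit is orthogonal to \<open>S\<close>
  because otherwise a small correction would come closer.\<close>

lemma orthogonal_projection:
  fixes S :: "'a::chilbert_space set"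
  assumes S: "csubspace S" and "closed S"
  shows "\<exists>s\<in>S. \<forall>y\<in>S. cinner (x - s) y = 0"
proof -
  note sub = S[unfolded csubspace_iff_subspace]
  have S_scaleR: "r *\<^sub>R y \<in> S" if "y \<in> S" for r y
    using scaleC.subspace_scale[OF sub that, of "of_real r"] by (simp add: scaleC_of_real)
  define d where "d = (INF s\<in>S. (norm (x - s))\<^sup>2)"
  have "S \<noteq> {}"
    using scaleC.subspace_0[OF sub] by blast
  have bdd: "bdd_below ((\<lambda>s. (norm (x - s))\<^sup>2) ` S)"
    by (rule bdd_belowI2[of _ 0]) simp
  have d_le: "d \<le> (norm (x - s))\<^sup>2" if "s \<in> S" for s
    unfolding d_def by (rule cINF_lower[OF bdd that])
  have "\<exists>s\<in>S. (norm (x - s))\<^sup>2 < d + 1 / real (Suc n)" for n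
    using cINF_less_iff[OF \<open>S \<noteq> {}\<close> bdd, of "d + 1 / real (Suc n)"] by (simp add: d_def)
  then obtain s where s_in: "\<And>n. s n \<in> S" and s: "\<And>n. (norm (x - s n))\<^sup>2 < d + 1 / real (Suc n)"
    by metis
  have close: "(norm (s m - s n))\<^sup>2 \<le> 2 / real (Suc m) + 2 / real (Suc n)" for m n
  proof -
    have "(1 / 2) *\<^sub>R (s m + s n) \<in> S"
      using s_in S_scaleR scaleC.subspace_add[OF sub] by blast
    then have "d \<le> (norm (x - (1 / 2) *\<^sub>R (s m + s n)))\<^sup>2"
      by (rule d_le)
    also have "x - (1 / 2) *\<^sub>R (s m + s n) = (1 / 2) *\<^sub>R ((x - s m) + (x - s n))"
      by (simp add: scaleR_diff_right scaleR_add_right algebra_simps flip: scaleR_add_left)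
    also have "(norm \<dots>)\<^sup>2 = (norm ((x - s m) + (x - s n)))\<^sup>2 / 4"
      by (simp add: power_mult_distrib power2_eq_square)
    finally have "4 * d \<le> (norm ((x - s m) + (x - s n)))\<^sup>2"
      by simp
    \<comment> \<open>The parallelogram law; the midpoint of \<open>s m\<close> and
      \<open>s n\<close> lies in \<open>S\<close>, which bounds the first term below by 4 d.\<close>
    moreover have "(norm ((x - s m) + (x - s n)))\<^sup>2 + (norm ((x - s n) - (x - s m)))\<^sup>2 =
        2 * (norm (x - s m))\<^sup>2 + 2 * (norm (x - s n))\<^sup>2"
      using norm_add_squared[of "x - s n" "x - s m"] norm_diff_squared[of "x - s n" "x - s m"]
      by (simp add: add.commute)
    moreover have "(x - s n) - (x - s m) = s m - s n"
      by simp
    ultimately show ?thesis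
      using s[of m] s[of n] by simp
  qed
  have "Cauchy s"
    unfolding Cauchy_def
  proof (intro allI impI)
    fix e :: real assume "e > 0"
    then obtain N where N: "4 / e\<^sup>2 < real N"
      using reals_Archimedean2 by blast
    have "dist (s m) (s n) < e" if "m \<ge> N" "n \<ge> N" for m n
    proof -
      have "real N > 0"
        using N \<open>e > 0\<close> by (smt (verit) divide_nonneg_nonneg zero_le_power2)
      then have "2 / real (Suc m) \<le> 2 / real N" "2 / real (Suc n) \<le> 2 / real N"
        using that by (auto intro!: divide_left_mono)
      then have "(norm (s m - s n))\<^sup>2 \<le> 4 / real N"
        using close[of m n] by simp
      also have "\<dots> < e\<^sup>2"
        using N \<open>e > 0\<close> \<open>real N > 0\<close> by (simp add: field_simps)
      finally show ?thesis
        using \<open>e > 0\<close> by (simp add: dist_norm power_less_imp_less_base)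
    qed
    then show "\<exists>M. \<forall>m\<ge>M. \<forall>n\<ge>M. dist (s m) (s n) < e"
      by blast
  qed
  then obtain l where l: "s \<longlonglongrightarrow> l"
    using Cauchy_convergent convergent_def by blast
  have "l \<in> S"
    using \<open>closed S\<close> s_in l closed_sequentially by blast
  have "(\<lambda>n. (norm (x - s n))\<^sup>2) \<longlonglongrightarrow> (norm (x - l))\<^sup>2"
    by (intro tendsto_intros l)
  moreover have "(\<lambda>n. d + 1 / real (Suc n)) \<longlonglongrightarrow> d + 0"
    using LIMSEQ_inverse_real_of_nat by (intro tendsto_intros) (simp add: inverse_eq_divide)
  ultimately have "(norm (x - l))\<^sup>2 \<le> d"
    using LIMSEQ_le[of "\<lambda>n. (norm (x - s n))\<^sup>2"] s by (fastforce intro: less_imp_le)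
  then have min: "(norm (x - l))\<^sup>2 \<le> (norm (x - y))\<^sup>2" if "y \<in> S" for y
    using d_le[OF that] by linarith
  have "cinner (x - l) y = 0" if "y \<in> S" for y
  proof (rule ccontr)
    assume nz: "cinner (x - l) y \<noteq> 0"
    then have "y \<noteq> 0"
      by auto
    define w where "w = cinner (x - l) y"
    \<comment> \<open>With this t, c y is the projection of the residual onto the line through y, so
      subtracting it would strictly reduce the distance.\<close>
    define t where "t = 1 / (norm y)\<^sup>2"
    define c where "c = of_real t * w"
    have "l + c *\<^sub>C y \<in> S"
      using sub \<open>l \<in> S\<close> that scaleC.subspace_add scaleC.subspace_scale by blast
    then have "(norm (x - l))\<^sup>2 \<le> (norm ((x - l) - c *\<^sub>C y))\<^sup>2"
      using min by (metis diff_diff_eq)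
    also have "\<dots> = (norm (x - l))\<^sup>2 - 2 * Re (cinner (x - l) (c *\<^sub>C y)) + (norm (c *\<^sub>C y))\<^sup>2"
      by (rule norm_diff_squared)
    also have "Re (cinner (x - l) (c *\<^sub>C y)) = t * (cmod w)\<^sup>2"
    proof -
      have "cinner (x - l) (c *\<^sub>C y) = of_real t * (w * cnj w)"
        by (simp add: cinner_scaleC_right c_def w_def)
      then show ?thesis
        by (simp add: complex_norm_square[symmetric] flip: of_real_power)
    qed
    also have "(norm (c *\<^sub>C y))\<^sup>2 = (cmod c)\<^sup>2 * (norm y)\<^sup>2"
    proof -
      have "complex_of_real ((norm (c *\<^sub>C y))\<^sup>2) = (c * cnj c) * complex_of_real ((norm y)\<^sup>2)"
        unfolding cinner_self_norm[symmetric] by (simp add: cinner_scaleC_left cinner_scaleC_right)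
      then show ?thesis
        by (metis complex_norm_square of_real_eq_iff of_real_mult)
    qed
    also have "(cmod c)\<^sup>2 * (norm y)\<^sup>2 = t * (cmod w)\<^sup>2"
      using \<open>y \<noteq> 0\<close> by (simp add: c_def t_def norm_mult norm_divide power_mult_distrib power2_eq_square)
    finally have "t * (cmod w)\<^sup>2 \<le> 0"
      by simp
    moreover have "t > 0" "(cmod w)\<^sup>2 > 0"
      using \<open>y \<noteq> 0\<close> nz by (simp_all add: t_def w_def)
    ultimately show False
      by (simp add: mult_le_0_iff)
  qed
  then show ?thesis
    using \<open>l \<in> S\<close> by blast
qed

section \<open>The product Hilbert space and graphs as its subspaces\<close>

instantiation prod :: (complex_inner_space, complex_inner_space) complex_inner_space
begin

definition scaleC_prod :: "complex \<Rightarrow> 'a \<times> 'b \<Rightarrow> 'a \<times> 'b" where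
  "scaleC_prod c p = (c *\<^sub>C fst p, c *\<^sub>C snd p)"

definition cinner_prod :: "'a \<times> 'b \<Rightarrow> 'a \<times> 'b \<Rightarrow> complex" where
  "cinner_prod p q = cinner (fst p) (fst q) + cinner (snd p) (snd q)"

instance
proof
  fix c d :: complex and r :: real and x y z :: "'a \<times> 'b"
  show "complex_of_real r *\<^sub>C x = r *\<^sub>R x"
    by (simp add: scaleC_prod_def scaleC_of_real scaleR_prod_def)
  show "c *\<^sub>C (x + y) = c *\<^sub>C x + c *\<^sub>C y"
    by (simp add: scaleC_prod_def scaleC_add_right)
  show "(c + d) *\<^sub>C x = c *\<^sub>C x + d *\<^sub>C x"
    by (simp add: scaleC_prod_def scaleC_add_left)
  show "c *\<^sub>C d *\<^sub>C x = (c * d) *\<^sub>C x"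
    by (simp add: scaleC_prod_def scaleC_scaleC)
  show "1 *\<^sub>C x = x"
    by (simp add: scaleC_prod_def scaleC_one)
  show "cinner x y = cnj (cinner y x)"
    unfolding cinner_prod_def complex_cnj_add by (metis cinner_commute)
  show "cinner (x + y) z = cinner x z + cinner y z"
    by (simp add: cinner_prod_def cinner_add_left)
  show "cinner (c *\<^sub>C x) y = c * cinner x y"
    by (simp add: cinner_prod_def scaleC_prod_def cinner_scaleC_left distrib_left)
  show "cinner x x = complex_of_real ((norm x)\<^sup>2)"
    by (simp add: cinner_prod_def norm_prod_def cinner_self_norm)
qed

end

instance prod :: (chilbert_space, chilbert_space) chilbert_space ..

definition graph :: "'a set \<Rightarrow> ('a \<Rightarrow> 'b) \<Rightarrow> ('a \<times> 'b) set" where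
  "graph D A = {(x, A x) | x. x \<in> D}"

lemma mem_graph_iff: "p \<in> graph D A \<longleftrightarrow> fst p \<in> D \<and> snd p = A (fst p)"
  by (cases p) (auto simp: graph_def)

lemma lin_op_iff_subspace_graph: "lin_op D A \<longleftrightarrow> scaleC.subspace (graph D A)"
proof
  assume lin: "lin_op D A"
  then have "0 \<in> D" "A (0 *\<^sub>C 0) = 0 *\<^sub>C A 0"
    unfolding lin_op_def csubspace_def by blast+
  then have "0 \<in> graph D A"
    by (simp add: mem_graph_iff)
  then show "scaleC.subspace (graph D A)"
    using lin unfolding lin_op_def csubspace_def scaleC.subspace_def
    by (auto simp: mem_graph_iff scaleC_prod_def)
next
  assume sub: "scaleC.subspace (graph D A)"
  have "0 \<in> D"
    using scaleC.subspace_0[OF sub] by (simp add: mem_graph_iff)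
  moreover have "x + y \<in> D \<and> A (x + y) = A x + A y" if "x \<in> D" "y \<in> D" for x y
    using scaleC.subspace_add[OF sub, of "(x, A x)" "(y, A y)"] that by (simp add: mem_graph_iff)
  moreover have "c *\<^sub>C x \<in> D \<and> A (c *\<^sub>C x) = c *\<^sub>C A x" if "x \<in> D" for c x
    using scaleC.subspace_scale[OF sub, of "(x, A x)" c] that
    by (simp add: mem_graph_iff scaleC_prod_def)
  ultimately show "lin_op D A"
    unfolding lin_op_def csubspace_def by blast
qed

lemma subspace_adjoint_graph: "scaleC.subspace (adjoint_graph D A)"
  by (rule scaleC.subspaceI)
    (auto simp: adjoint_graph_def scaleC_prod_def zero_prod_def cinner_add_right cinner_scaleC_right)

lemma graph_subset_adjoint_graph: "symmetric_op D A \<Longrightarrow> graph D A \<subseteq> adjoint_graph D A"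
  by (auto simp: symmetric_op_def graph_def adjoint_graph_def)

text \<open>Von Neumann's formula: if \<open>(u, u')\<close> in the graph of the adjoint is orthogonal to the graph of
  \<open>A\<close>, then \<open>(u', - u)\<close> lies in the graph of the adjoint as well, so \<open>u \<mp> \<i> u'\<close> are defect vectors.\<close>

lemma adjoint_graph_subset_span:
  fixes D :: "'h::chilbert_space set"
  assumes "closed_op D A" and "symmetric_op D A" and "finite_deficiency D A"
  obtains B where "finite B" and "adjoint_graph D A \<subseteq> scaleC.span (graph D A \<union> B)"
proof -
  obtain S1 S2 where S1: "finite S1" "defect_space D A \<i> \<subseteq> cspan S1"
    and S2: "finite S2" "defect_space D A (- \<i>) \<subseteq> cspan S2"
    using assms(3) unfolding finite_deficiency_def cfinite_dim_def by blast
  define B where "B = (\<lambda>g. (g, \<i> *\<^sub>C g)) ` S1 \<union> (\<lambda>g. (g, (- \<i>) *\<^sub>C g)) ` S2"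
  \<comment> \<open>The map g to (g, z g) is linear, so it suffices that \<open>B\<close> contains
    the images of a spanning set.\<close>
  have defect_in: "(g, z *\<^sub>C g) \<in> scaleC.span B"
    if "(\<lambda>g. (g, z *\<^sub>C g)) ` T \<subseteq> B" "g \<in> cspan T" for z g T
  proof -
    have "scaleC.subspace {g. (g, z *\<^sub>C g) \<in> scaleC.span B}"
    proof (rule scaleC.subspaceI)
      show "0 \<in> {g. (g, z *\<^sub>C g) \<in> scaleC.span B}"
        by (simp add: scaleC.span_zero flip: zero_prod_def)
      show "x + y \<in> {g. (g, z *\<^sub>C g) \<in> scaleC.span B}"
        if "x \<in> {g. (g, z *\<^sub>C g) \<in> scaleC.span B}" "y \<in> {g. (g, z *\<^sub>C g) \<in> scaleC.span B}" for x y
        using scaleC.span_add that by (fastforce simp: scaleC_add_right)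
      show "c *\<^sub>C x \<in> {g. (g, z *\<^sub>C g) \<in> scaleC.span B}"
        if "x \<in> {g. (g, z *\<^sub>C g) \<in> scaleC.span B}" for c x
        using scaleC.span_scale[of "(x, z *\<^sub>C x)" B c] that
        by (simp add: scaleC_prod_def scaleC_scaleC mult.commute)
    qed
    moreover have "T \<subseteq> {g. (g, z *\<^sub>C g) \<in> scaleC.span B}"
      using that(1) by (auto intro: scaleC.span_base)
    ultimately show ?thesis
      using scaleC.span_minimal cspan_subset_span that(2) by blast
  qed
  have sub: "scaleC.subspace (adjoint_graph D A)"
    by (rule subspace_adjoint_graph)
  have graph: "csubspace (graph D A)" "closed (graph D A)"
    using assms(1) by (simp_all add: closed_op_def csubspace_iff_subspace lin_op_iff_subspace_graph graph_def)
  have "p \<in> scaleC.span (graph D A \<union> B)" if p: "p \<in> adjoint_graph D A" for p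
  proof -
    obtain s where s: "s \<in> graph D A" "\<And>y. y \<in> graph D A \<Longrightarrow> cinner (p - s) y = 0"
      using orthogonal_projection[OF graph] by blast
    obtain u u' where u: "p - s = (u, u')"
      by fastforce
    have adj: "(u, u') \<in> adjoint_graph D A"
      using scaleC.subspace_diff[OF sub p] s(1) graph_subset_adjoint_graph[OF assms(2)]
      unfolding u[symmetric] by blast
    \<comment> \<open>This is orthogonality of (u, u') to (x, A x), rearranged and
      conjugated.\<close>
    have "cinner (A x) u' = cinner x (- u)" if "x \<in> D" for x
    proof -
      have "cinner u x + cinner u' (A x) = 0"
        using s(2)[of "(x, A x)"] that by (simp add: u cinner_prod_def graph_def)
      then have "cnj (cinner u x) + cnj (cinner u' (A x)) = 0"
        by (metis complex_cnj_add complex_cnj_zero)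
      then show ?thesis
        using cinner_commute[of x u] cinner_commute[of "A x" u']
        by (simp add: cinner_minus_right add_eq_0_iff)
    qed
    then have adj': "(u', - u) \<in> adjoint_graph D A"
      by (simp add: adjoint_graph_def)
    define \<alpha> where "\<alpha> = u - \<i> *\<^sub>C u'"
    define \<beta> where "\<beta> = u + \<i> *\<^sub>C u'"
    \<comment> \<open>Both defect pairs are combinations of (u, u') and (u', -u), hence in the graph
      of the adjoint; half their sum is (u, u').\<close>
    have \<alpha>: "(\<alpha>, \<i> *\<^sub>C \<alpha>) = (u, u') - \<i> *\<^sub>C (u', - u)"
      by (simp add: \<alpha>_def scaleC_prod_def scaleC.scale_right_diff_distrib scaleC_scaleC)
    have \<beta>: "(\<beta>, (- \<i>) *\<^sub>C \<beta>) = (u, u') + \<i> *\<^sub>C (u', - u)"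
      by (simp add: \<beta>_def scaleC_prod_def scaleC_add_right scaleC_scaleC)
    have "\<alpha> \<in> defect_space D A \<i>"
      unfolding defect_space_def \<alpha> mem_Collect_eq
      using adj adj' sub by (intro scaleC.subspace_diff scaleC.subspace_scale)
    then have "(\<alpha>, \<i> *\<^sub>C \<alpha>) \<in> scaleC.span B"
      using S1 by (intro defect_in[of _ S1]) (auto simp: B_def)
    moreover have "\<beta> \<in> defect_space D A (- \<i>)"
      unfolding defect_space_def \<beta> mem_Collect_eq
      using adj adj' sub by (intro scaleC.subspace_add scaleC.subspace_scale)
    then have "(\<beta>, (- \<i>) *\<^sub>C \<beta>) \<in> scaleC.span B"
      using S2 by (intro defect_in[of _ S2]) (auto simp: B_def)
    ultimately have "(1 / 2) *\<^sub>C ((\<alpha>, \<i> *\<^sub>C \<alpha>) + (\<beta>, (- \<i>) *\<^sub>C \<beta>)) \<in> scaleC.span B"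
      by (intro scaleC.span_scale scaleC.span_add)
    moreover have "(1 / 2) *\<^sub>C ((\<alpha>, \<i> *\<^sub>C \<alpha>) + (\<beta>, (- \<i>) *\<^sub>C \<beta>)) = (u, u')"
    proof -
      have "(p - w) + (p + w) = 2 *\<^sub>C p" for p w :: "'h \<times> 'h"
        using scaleC_add_left[of 1 1 p] by (simp add: scaleC_one)
      then show ?thesis
        unfolding \<alpha> \<beta> by (simp only: scaleC_scaleC) (simp add: scaleC_one)
    qed
    ultimately have "p - s \<in> scaleC.span (graph D A \<union> B)"
      unfolding u using scaleC.span_mono[of B "graph D A \<union> B"] by auto
    moreover have "s \<in> scaleC.span (graph D A \<union> B)"
      using s(1) by (auto intro: scaleC.span_base)
    ultimately show ?thesis
      using scaleC.span_add[of "p - s" _ s] by simp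
  qed
  moreover have "finite B"
    using S1 S2 by (simp add: B_def)
  ultimately show thesis
    using that by blast
qed

section \<open>The affine group and its unitary representations\<close>

lemma aff_comp_assoc: "aff_comp (aff_comp x y) z = aff_comp x (aff_comp y z)"
  by (simp add: aff_comp_def algebra_simps)

lemma aff_comp_id [simp]: "aff_comp aff_id x = x" "aff_comp x aff_id = x"
  by (simp_all add: aff_comp_def aff_id_def)

lemma aff_comp_inv:
  assumes "x \<in> aff_group"
  shows "aff_comp x (aff_inv x) = aff_id" "aff_comp (aff_inv x) x = aff_id"
  using assms by (simp_all add: aff_comp_def aff_inv_def aff_id_def aff_group_def)

lemma aff_inv_unique:
  assumes "x \<in> aff_group" "aff_comp x y = aff_id"
  shows "y = aff_inv x"
  by (metis aff_comp_assoc aff_comp_id aff_comp_inv(2) assms)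

text \<open>Stated for any abelian parameter group, so that the integers give the cyclic case and
  the reals the one-parameter case.\<close>

lemma aff_hom_range:
  fixes \<phi> :: "'i::ab_group_add \<Rightarrow> real \<times> real"
  assumes hom: "\<And>s t. \<phi> (s + t) = aff_comp (\<phi> s) (\<phi> t)" and "range \<phi> \<subseteq> aff_group"
  shows "\<forall>g\<in>range \<phi>. aff_inv g \<in> range \<phi>"
    and "\<forall>g\<in>range \<phi>. \<forall>h\<in>range \<phi>. aff_comp g h = aff_comp h g"
proof -
  have grp: "\<phi> s \<in> aff_group" for s
    using assms(2) by blast
  have "\<phi> 0 = aff_comp (\<phi> 0) (\<phi> 0)"
    using hom[of 0 0] by simp
  then have "\<phi> 0 = aff_id"
    by (metis aff_comp_assoc aff_comp_id(1) aff_comp_inv(2) grp)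
  then have "aff_inv (\<phi> s) = \<phi> (- s)" for s
    using aff_inv_unique[OF grp, of s "\<phi> (- s)"] hom[of s "- s"] by simp
  then show "\<forall>g\<in>range \<phi>. aff_inv g \<in> range \<phi>"
    by auto
  show "\<forall>g\<in>range \<phi>. \<forall>h\<in>range \<phi>. aff_comp g h = aff_comp h g"
    by (auto simp: add.commute simp flip: hom)
qed

lemma aff_ipow_in_aff_group:
  assumes "g \<in> aff_group"
  shows "aff_ipow g k \<in> aff_group"
proof -
  have "fst ((aff_comp h ^^ n) aff_id) = fst h ^ n" for h n
    by (induction n) (simp_all add: aff_comp_def aff_id_def)
  then show ?thesis
    using assms by (simp add: aff_ipow_def aff_group_def aff_inv_def)
qed

lemma aff_ipow_add_one:
  assumes "g \<in> aff_group"
  shows "aff_ipow g (k + 1) = aff_comp g (aff_ipow g k)"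
proof (cases "k \<ge> 0")
  case True
  then have "nat (k + 1) = Suc (nat k)"
    by simp
  then show ?thesis
    using True by (simp add: aff_ipow_def)
next
  case False
  then have "nat (- k) = Suc (nat (- (k + 1)))"
    by simp
  then have "aff_ipow g k = aff_comp (aff_inv g) (aff_ipow g (k + 1))"
    \<comment> \<open>For k = -1 the exponent k + 1 = 0 falls into the nonnegative branch of
      \<open>aff_ipow\<close>.\<close>
    using False by (cases "k = - 1") (simp_all add: aff_ipow_def)
  then show ?thesis
    by (metis aff_comp_assoc aff_comp_id(1) aff_comp_inv(1) assms)
qed

text \<open>Makes \<open>aff_ipow g\<close> a homomorphism from the integers, as
  \<open>aff_hom_range\<close> requires. The downward induction step is proved after composing with
  g, which is then cancelled.\<close>

lemma aff_ipow_add: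
  assumes "g \<in> aff_group"
  shows "aff_ipow g (j + k) = aff_comp (aff_ipow g j) (aff_ipow g k)"
proof (induction j rule: int_induct[where k = 0])
  case base
  then show ?case
    by (simp add: aff_ipow_def)
next
  case (step1 i)
  then show ?case
    using aff_ipow_add_one[OF assms, of "i + k"] aff_ipow_add_one[OF assms, of i]
    by (simp add: aff_comp_assoc algebra_simps)
next
  case (step2 i)
  have "aff_comp g (aff_ipow g (i - 1 + k)) = aff_comp g (aff_comp (aff_ipow g (i - 1)) (aff_ipow g k))"
    using step2 aff_ipow_add_one[OF assms, of "i - 1 + k"] aff_ipow_add_one[OF assms, of "i - 1"]
    by (simp add: algebra_simps flip: aff_comp_assoc)
  then show ?case
    by (metis aff_comp_assoc aff_comp_id(1) aff_comp_inv(2) assms)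
qed

lemma cyclic_or_one_param_subgroup:
  assumes "cyclic_subgroup G \<or> one_param_subgroup G"
  shows "G \<subseteq> aff_group" and "\<forall>g\<in>G. aff_inv g \<in> G"
    and "\<forall>g\<in>G. \<forall>h\<in>G. aff_comp g h = aff_comp h g"
proof -
  have "G \<subseteq> aff_group \<and> (\<forall>g\<in>G. aff_inv g \<in> G) \<and> (\<forall>g\<in>G. \<forall>h\<in>G. aff_comp g h = aff_comp h g)"
    using assms
  proof
    assume "cyclic_subgroup G"
    then obtain g where g: "g \<in> aff_group" "G = range (aff_ipow g)"
      unfolding cyclic_subgroup_def by blast
    have "range (aff_ipow g) \<subseteq> aff_group"
      using aff_ipow_in_aff_group[OF g(1)] by blast
    then show ?thesis
      using aff_hom_range[of "aff_ipow g", OF aff_ipow_add[OF g(1)]] unfolding g(2) by blast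
  next
    assume "one_param_subgroup G"
    then obtain \<phi> :: "real \<Rightarrow> real \<times> real" where "range \<phi> \<subseteq> aff_group"
        "\<And>s t. \<phi> (s + t) = aff_comp (\<phi> s) (\<phi> t)" "G = range \<phi>"
      unfolding one_param_subgroup_def by blast
    then show ?thesis
      using aff_hom_range[of \<phi>] by blast
  qed
  then show "G \<subseteq> aff_group" and "\<forall>g\<in>G. aff_inv g \<in> G"
    and "\<forall>g\<in>G. \<forall>h\<in>G. aff_comp g h = aff_comp h g"
    by blast+
qed

section \<open>The action of the representation on graphs\<close>

lemma cadjoint_unitary:
  assumes "unitary T" and "\<And>x. T (T' x) = x"
  shows "cadjoint T = T'"
proof
  fix y
  have *: "cinner (T x) y = cinner x (T' y)" for x
    using assms(1) assms(2)[of y] unfolding unitary_def by metis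
  show "cadjoint T y = T' y"
    unfolding cadjoint_def by (rule the_equality) (auto simp: * intro: cinner_right_eqI)
qed

text \<open>\<open>graph_action U g\<close> maps the graph of \<open>A\<close> onto that of \<open>g\<inverse>(U\<^sub>g A U\<^sub>g\<^sup>*)\<close>, so an operator is
  \<open>G\<close>-invariant exactly when its graph is an invariant subspace.\<close>

definition graph_action :: "(real \<times> real \<Rightarrow> 'h \<Rightarrow> 'h) \<Rightarrow> real \<times> real \<Rightarrow> 'h \<times> 'h \<Rightarrow> 'h::complex_inner_space \<times> 'h" where
  "graph_action U g p = (U g (fst p), (1 / fst g) *\<^sub>R (U g (snd p) - snd g *\<^sub>R U g (fst p)))"

definition boundary_form :: "'h::complex_inner_space \<times> 'h \<Rightarrow> 'h \<times> 'h \<Rightarrow> complex" where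
  "boundary_form p q = - \<i> * (cinner (snd p) (fst q) - cinner (fst p) (snd q))"

lemma Re_boundary_form_self: "Re (boundary_form p p) = 2 * Im (cinner (snd p) (fst p))"
  using cinner_commute[of "fst p" "snd p"] by (simp add: boundary_form_def)

lemma boundary_form_graph_eq_0_iff:
  "(\<forall>p\<in>graph D A. boundary_form p q = 0) \<longleftrightarrow> q \<in> adjoint_graph D A"
  by (cases q) (auto simp: boundary_form_def graph_def adjoint_graph_def)

locale affine_rep =
  fixes G :: "(real \<times> real) set" and U :: "real \<times> real \<Rightarrow> 'h::complex_inner_space \<Rightarrow> 'h"
  assumes rep: "unitary_rep G U" and aff: "G \<subseteq> aff_group"
    and inv_closed: "\<forall>g\<in>G. aff_inv g \<in> G"
    and commutative: "\<forall>g\<in>G. \<forall>h\<in>G. aff_comp g h = aff_comp h g"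
begin

context
  fixes g
  assumes g: "g \<in> G"
begin

lemma fst_pos: "fst g > 0"
  using g aff by (auto simp: aff_group_def)

lemma U_add: "U g (x + y) = U g x + U g y"
  and U_scaleC: "U g (c *\<^sub>C x) = c *\<^sub>C U g x"
  and U_cinner: "cinner (U g x) (U g y) = cinner x y"
  using rep g unfolding unitary_rep_def unitary_def by blast+

lemma U_diff: "U g (x - y) = U g x - U g y"
  using U_add[of "x - y" y] by simp

lemma U_scaleR: "U g (r *\<^sub>R x) = r *\<^sub>R U g x"
  by (simp add: U_scaleC flip: scaleC_of_real)

lemma U_inv: "U g (U (aff_inv g) x) = x" "U (aff_inv g) (U g x) = x"
proof -
  have "U g \<circ> U (aff_inv g) = U aff_id" "U (aff_inv g) \<circ> U g = U aff_id" "U aff_id = id"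
    using rep g inv_closed aff_comp_inv[of g] aff unfolding unitary_rep_def by (metis subsetD)+
  then show "U g (U (aff_inv g) x) = x" "U (aff_inv g) (U g x) = x"
    by (metis comp_apply id_apply)+
qed

lemma cadjoint_U: "cadjoint (U g) = U (aff_inv g)"
  by (rule cadjoint_unitary) (use rep g U_inv in \<open>auto simp: unitary_rep_def\<close>)

text \<open>The translation part of g is real, so its two contributions cancel; the dilation part
  leaves the factor.\<close>

lemma boundary_form_graph_action:
  "boundary_form (graph_action U g p) (graph_action U g q) = of_real (1 / fst g) * boundary_form p q"
  by (simp add: boundary_form_def graph_action_def cinner_scaleR_left cinner_scaleR_right
    cinner_diff_left cinner_diff_right U_cinner algebra_simps)

lemma linear_graph_action: "Vector_Spaces.linear scaleC scaleC (graph_action U g)"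
  by unfold_locales
    (simp_all add: graph_action_def U_add U_scaleC scaleC_prod_def scaleC_add_right
      scaleC.scale_right_diff_distrib scaleC_scaleC mult.commute algebra_simps flip: scaleC_of_real)

text \<open>Invariance at the vector U_g f reads U_g A f = a A U_g f + b U_g f with g = (a, b);
  solve this for A U_g f.\<close>

lemma graph_action_in_graph:
  assumes inv: "G_invariant G U D A" and p: "p \<in> graph D A"
  shows "graph_action U g p \<in> graph D A"
proof -
  have f: "fst p \<in> D" "snd p = A (fst p)"
    using p by (simp_all add: mem_graph_iff)
  then have Uf: "U g (fst p) \<in> D"
    using inv g unfolding G_invariant_def by blast
  then have "U g (A (U (aff_inv g) (U g (fst p)))) = fst g *\<^sub>R A (U g (fst p)) + snd g *\<^sub>R U g (fst p)"
    using inv g unfolding G_invariant_def cadjoint_U[symmetric] by blast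
  then show ?thesis
    using f Uf fst_pos by (simp add: mem_graph_iff graph_action_def U_inv)
qed

end

lemma graph_action_inv:
  assumes "g \<in> G"
  shows "graph_action U (aff_inv g) (graph_action U g p) = p"
proof -
  have k: "aff_inv g \<in> G"
    using assms inv_closed by blast
  have "fst (aff_inv g) = 1 / fst g" "snd (aff_inv g) = - snd g / fst g"
    by (simp_all add: aff_inv_def)
  then show ?thesis
    using fst_pos[OF assms]
    by (simp add: graph_action_def U_diff[OF k] U_scaleR[OF k] U_inv[OF assms] prod_eq_iff
      scaleR_diff_right)
qed

lemma graph_action_commute:
  assumes g: "g \<in> G" and h: "h \<in> G"
  shows "graph_action U g (graph_action U h p) = graph_action U h (graph_action U g p)"
proof -
  have comm: "aff_comp g h = aff_comp h g"
    using commutative g h by blast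
  then have UU: "U g (U h x) = U h (U g x)" for x
    using rep g h unfolding unitary_rep_def by (metis comp_apply)
  have "fst g * snd h + snd g = fst h * snd g + snd h"
    using comm by (simp add: aff_comp_def)
  \<comment> \<open>Commutativity of g and h divided by the product of their dilations: these are
    the coefficients with which the translation parts enter the two composites.\<close>
  then have "snd h / fst h + snd g / (fst g * fst h) = snd g / fst g + snd h / (fst g * fst h)"
    using fst_pos[OF g] fst_pos[OF h] by (simp add: field_simps)
  then have "(snd h / fst h) *\<^sub>R y + (snd g / (fst g * fst h)) *\<^sub>R y =
      (snd g / fst g) *\<^sub>R y + (snd h / (fst g * fst h)) *\<^sub>R y" for y :: 'h
    unfolding scaleR_add_left[symmetric] by simp
  then show ?thesis
    using fst_pos[OF g] fst_pos[OF h]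
    by (simp add: graph_action_def U_diff[OF g] U_diff[OF h] U_scaleR[OF g] U_scaleR[OF h] UU
      scaleR_diff_right field_simps)
qed

lemma G_invariantI:
  assumes graph: "\<And>g p. g \<in> G \<Longrightarrow> p \<in> graph D A \<Longrightarrow> graph_action U g p \<in> graph D A"
  shows "G_invariant G U D A"
  unfolding G_invariant_def
proof (intro ballI conjI)
  fix g assume g: "g \<in> G"
  then have k: "aff_inv g \<in> G"
    using inv_closed by blast
  have step: "U h f \<in> D" "A (U h f) = (1 / fst h) *\<^sub>R (U h (A f) - snd h *\<^sub>R U h f)"
    if "h \<in> G" "f \<in> D" for h f
    using graph[OF that(1), of "(f, A f)"] that(2) by (simp_all add: mem_graph_iff graph_action_def)
  show "U g ` D = D"
    using step(1)[OF g] step(1)[OF k] U_inv(1)[OF g] by (metis image_eqI image_subsetI subsetI subset_antisym)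
  fix f assume "f \<in> D"
  then have "A f = (1 / fst g) *\<^sub>R (U g (A (U (aff_inv g) f)) - snd g *\<^sub>R f)"
    using step(2)[OF g step(1)[OF k]] U_inv(1)[OF g] by metis
  then show "U g (A (cadjoint (U g) f)) = fst g *\<^sub>R A f + snd g *\<^sub>R f"
    using fst_pos[OF g] by (simp add: cadjoint_U[OF g])
qed

text \<open>The graph of the adjoint is the orthogonal complement of \<open>graph D A\<close>, and
  each p in that graph is the image under g of another point of it. Since the form is only rescaled,
  orthogonality carries over.\<close>

lemma graph_action_in_adjoint_graph:
  assumes "G_invariant G U D A" and g: "g \<in> G" and q: "q \<in> adjoint_graph D A"
  shows "graph_action U g q \<in> adjoint_graph D A"
  unfolding boundary_form_graph_eq_0_iff[symmetric]
proof
  fix p assume p: "p \<in> graph D A"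
  have k: "aff_inv g \<in> G"
    using g inv_closed by blast
  have "aff_inv (aff_inv g) = g"
    using fst_pos[OF g] by (simp add: aff_inv_def)
  then have "p = graph_action U g (graph_action U (aff_inv g) p)"
    using graph_action_inv[OF k] by simp
  moreover have "boundary_form (graph_action U (aff_inv g) p) q = 0"
    using graph_action_in_graph[OF k assms(1) p] q boundary_form_graph_eq_0_iff by blast
  ultimately show "boundary_form p (graph_action U g q) = 0"
    using boundary_form_graph_action[OF g, of "graph_action U (aff_inv g) p" q] by simp
qed

sublocale hermitian_form_symmetries scaleC boundary_form "graph_action U ` G"
proof (rule hermitian_form_symmetries.intro[OF scaleC.complex_vector_space_axioms],
    rule hermitian_form_symmetries_axioms.intro)
  fix x y z :: "'h \<times> 'h" and c :: complex and W V :: "'h \<times> 'h \<Rightarrow> 'h \<times> 'h"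
  show "boundary_form (x + y) z = boundary_form x z + boundary_form y z"
    by (simp add: boundary_form_def cinner_add_left algebra_simps)
  show "boundary_form (c *\<^sub>C x) z = c * boundary_form x z"
    by (simp add: boundary_form_def scaleC_prod_def cinner_scaleC_left algebra_simps)
  show "boundary_form x y = cnj (boundary_form y x)"
    using cinner_commute[of "fst x" "snd y"] cinner_commute[of "snd x" "fst y"]
    by (simp add: boundary_form_def algebra_simps)
  show "Vector_Spaces.linear scaleC scaleC W" if "W \<in> graph_action U ` G"
    using that linear_graph_action by blast
  show "W (V x) = V (W x)" if "W \<in> graph_action U ` G" "V \<in> graph_action U ` G"
    using that graph_action_commute by blast
  show "\<exists>V\<in>graph_action U ` G. \<forall>x. V (W x) = x" if "W \<in> graph_action U ` G"
    using that inv_closed graph_action_inv by blast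
  show "boundary_form (W x) (W y) = 0" if "W \<in> graph_action U ` G" "boundary_form x y = 0"
    using that by (elim imageE) (simp only: boundary_form_graph_action mult_zero_right)
qed

end

theorem theorem5p4:
  fixes G :: "(real \<times> real) set"
    and U :: "real \<times> real \<Rightarrow> 'h::chilbert_space \<Rightarrow> 'h"
    and D :: "'h set" and A :: "'h \<Rightarrow> 'h"
  assumes "cyclic_subgroup G \<or> one_param_subgroup G"
    and "unitary_rep G U"
    and "one_param_subgroup G \<longrightarrow> strongly_continuous G U"
    and "closed_op D A" and "densely_defined D" and "symmetric_op D A"
    and "finite_deficiency D A"
    and "G_invariant G U D A"
  shows "\<exists>D' A'. D \<subseteq> D' \<and> (\<forall>f\<in>D. A' f = A f) \<and> max_dissipative D' A' \<and> G_invariant G U D' A'"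
proof -
  interpret affine_rep G U
    using cyclic_or_one_param_subgroup[OF assms(1)] assms(2) by unfold_locales
  let ?S = "graph D A" and ?R = "adjoint_graph D A"
  have S_sub: "scaleC.subspace ?S"
    using assms(4) by (simp add: closed_op_def lin_op_iff_subspace_graph)
  have S_R: "?S \<subseteq> ?R"
    by (rule graph_subset_adjoint_graph[OF assms(6)])
  have "invariant ?S" "invariant ?R"
    unfolding invariant_def using graph_action_in_graph graph_action_in_adjoint_graph assms(8) by blast+
  moreover obtain B where "finite B" "?R \<subseteq> scaleC.span (?S \<union> B)"
    using adjoint_graph_subset_span[OF assms(4,6,7)] by blast
  moreover have S_R_form: "boundary_form p q = 0" if "p \<in> ?S" "q \<in> ?R" for p q
    using that boundary_form_graph_eq_0_iff by blast
  ultimately obtain M where M: "maximal_nonneg_in ?R M" "invariant M" "?S \<subseteq> M"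
    using exists_invariant_maximal_nonneg[of B ?S ?R] S_sub subspace_adjoint_graph[of D A] S_R by blast
  have M_sub: "scaleC.subspace M" "nonneg M" "M \<subseteq> ?R"
    using M(1) by (simp_all add: maximal_nonneg_in_def)
  \<comment> \<open>Makes M single-valued: a pair (0, k) in the graph of the adjoint has k
    orthogonal to the dense \<open>D\<close>.\<close>
  have M_fun: "h = h'" if "(f, h) \<in> M" "(f, h') \<in> M" for f h h'
  proof -
    have "(0, h - h') \<in> ?R"
      using scaleC.subspace_diff[OF M_sub(1) that] M_sub(3) by auto
    then have "h - h' = 0"
      by (intro densely_defined_orthogonal_eq_0[OF assms(5)]) (simp add: adjoint_graph_def)
    then show ?thesis
      by simp
  qed
  define D' where "D' = fst ` M"
  define A' where "A' f = (THE h. (f, h) \<in> M)" for f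
  have A'_eq: "A' f = h" if "(f, h) \<in> M" for f h
    unfolding A'_def using that M_fun by blast
  have graph': "graph D' A' = M"
    by (force simp: mem_graph_iff D'_def A'_eq)
  have "D \<subseteq> D'" "\<forall>f\<in>D. A' f = A f"
    using M(3) A'_eq by (force simp: D'_def graph_def)+
  moreover have "G_invariant G U D' A'"
    by (rule G_invariantI) (use M(2) in \<open>auto simp: graph' invariant_def\<close>)
  moreover have nonneg_graph: "nonneg (graph E T) \<longleftrightarrow> (\<forall>f\<in>E. Im (cinner (T f) f) \<ge> 0)" for E T
    by (auto simp: nonneg_def graph_def Re_boundary_form_self)
  have "max_dissipative D' A'"
    unfolding max_dissipative_def
  proof (intro conjI allI impI)
    show "dissipative D' A'"
      unfolding dissipative_def lin_op_iff_subspace_graph using M_sub nonneg_graph graph' by metis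
    fix E T assume ext: "dissipative E T \<and> D' \<subseteq> E \<and> (\<forall>f\<in>D'. T f = A' f)"
    define L where "L = graph E T"
    have L: "scaleC.subspace L" "nonneg L"
      using ext nonneg_graph by (simp_all add: L_def dissipative_def lin_op_iff_subspace_graph)
    have "M \<subseteq> L"
      unfolding graph'[symmetric] L_def using ext by (auto simp: mem_graph_iff)
    \<comment> \<open>Upgrades maximality inside the graph of the adjoint to maximality among all
      dissipative operators: graph vectors of \<open>A\<close> are neutral and lie in the
      nonnegative \<open>L\<close>, so \<open>L\<close> is orthogonal to them.\<close>
    have "L \<subseteq> ?R"
    proof
      fix q assume "q \<in> L"
      have "boundary_form p q = 0" if "p \<in> ?S" for p
      proof -
        have "boundary_form p p = 0" "p \<in> L"
          using that S_R S_R_form M(3) \<open>M \<subseteq> L\<close> by blast+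
        then show ?thesis
          using nonneg_neutral_orthogonal[OF L _ \<open>q \<in> L\<close>] form_eq_0_commute by blast
      qed
      then show "q \<in> ?R"
        using boundary_form_graph_eq_0_iff by blast
    qed
    then have "L = M"
      using M(1) L \<open>M \<subseteq> L\<close> unfolding maximal_nonneg_in_def by blast
    then have "fst ` graph E T = D'"
      by (simp add: L_def D'_def)
    then show "E = D'"
      by (force simp: graph_def)
  qed
  ultimately show ?thesis
    by blast
qed

end
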